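(* Let $\Delta$ be a $(d-1)$-dimensional Boolean cell complex. Then for $0 \leq j \leq d$, $$h_j^{\mathrm{sd}(\Delta)} = \sum_{r=0}^{d} A(d+1,j,r+1)\, h_r^\Delta.$$
   Context: A Boolean cell complex is a regular CW-complex $\Delta$, regarded as the poset of its cells (faces) ordered by closure containment, with the empty cell included as least element, such that every lower interval $[\emptyset, A]$ is a Boolean lattice. For a $(d-1)$-dimensional Boolean cell complex, $f_{i}^\Delta$ ($-1 \le i \le d-1$) is the number of $i$-dimensional faces ($f_{-1}^\Delta=1$), and the $h$-vector is defined by $\sum_{i=0}^d h_i^\Delta t^{d-i} = \sum_{i=0}^d f_{i-1}^\Delta (t-1)^{d-i}$. The barycentric subdivision $\mathrm{sd}(\Delta)$ is the simplicial complex whose vertices are the non-empty faces of $\Delta$ and whose faces are strictly increasing chains of non-empty faces. For $\sigma$ in the symmetric group $S_m$, $\mathrm{des}(\sigma) = \#\{ i \in [m-1] : \sigma(i) > \sigma(i+1)\}$. For $m \ge 1$ and integers $i,j$, $A(m,i,j)$ denotes the number of $\sigma \in S_m$ with $\sigma(1)=j$ and $\mathrm{des}(\sigma) = i$ (so $A(m,i,j)=0$ if $i\le -1$, $i \ge m$, or $j\notin[m]$). *)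

theory Defs
  imports
    "HOL-Analysis.Analysis"
    "HOL-Computational_Algebra.Polynomial"
    "HOL-Combinatorics.Permutations"
begin

section \<open>Regular CW-complexes\<close>

text \<open>The closed unit ball, open unit ball and unit sphere of n-dimensional Euclidean space.
  For n = 0 both balls are a single point and the sphere is empty.\<close>

definition disk :: "nat \<Rightarrow> (nat \<Rightarrow> real) set" where
  "disk n = {x \<in> topspace (Euclidean_space n). (\<Sum>i<n. (x i)\<^sup>2) \<le> 1}"

definition open_disk :: "nat \<Rightarrow> (nat \<Rightarrow> real) set" where
  "open_disk n = {x \<in> topspace (Euclidean_space n). (\<Sum>i<n. (x i)\<^sup>2) < 1}"

definition disk_boundary :: "nat \<Rightarrow> (nat \<Rightarrow> real) set" where
  "disk_boundary n = {x \<in> topspace (Euclidean_space n). (\<Sum>i<n. (x i)\<^sup>2) = 1}"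

text \<open>The dimension of an open cell; it is well defined by invariance of dimension.\<close>

definition cell_dim :: "'a topology \<Rightarrow> 'a set \<Rightarrow> nat" where
  "cell_dim X e =
    (THE n. subtopology X e homeomorphic_space subtopology (Euclidean_space n) (open_disk n))"

text \<open>The last conjunct is closure-finiteness: the boundary of an n-cell is attached to finitely
  many cells of dimension less than n.\<close>

definition characteristic_map ::
  "'a topology \<Rightarrow> 'a set set \<Rightarrow> nat \<Rightarrow> 'a set \<Rightarrow> ((nat \<Rightarrow> real) \<Rightarrow> 'a) \<Rightarrow> bool" where
  "characteristic_map X C n e \<phi> \<longleftrightarrow>
     continuous_map (subtopology (Euclidean_space n) (disk n)) X \<phi> \<and>
     homeomorphic_map (subtopology (Euclidean_space n) (open_disk n)) (subtopology X e) \<phi> \<and>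
     (\<exists>F. finite F \<and> F \<subseteq> C \<and> (\<forall>e'\<in>F. cell_dim X e' < n) \<and> \<phi> ` disk_boundary n \<subseteq> \<Union>F)"

text \<open>A CW-complex is a Hausdorff space X partitioned into the set C of its open cells; the last
  conjunct says that X carries the weak topology.\<close>

definition cw_complex :: "'a topology \<Rightarrow> 'a set set \<Rightarrow> bool" where
  "cw_complex X C \<longleftrightarrow>
     Hausdorff_space X \<and>
     \<Union>C = topspace X \<and> disjoint C \<and>
     (\<forall>e\<in>C. \<exists>n \<phi>. characteristic_map X C n e \<phi>) \<and>
     (\<forall>S. S \<subseteq> topspace X \<and> (\<forall>e\<in>C. closedin X (S \<inter> X closure_of e)) \<longrightarrow> closedin X S)"

definition regular_cw_complex :: "'a topology \<Rightarrow> 'a set set \<Rightarrow> bool" where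
  "regular_cw_complex X C \<longleftrightarrow>
     cw_complex X C \<and>
     (\<forall>e\<in>C. \<exists>n \<phi>. characteristic_map X C n e \<phi> \<and>
        embedding_map (subtopology (Euclidean_space n) (disk n)) X \<phi>)"

section \<open>Boolean cell complexes\<close>

text \<open>Cells are non-empty sets, so the empty set can serve as the empty cell.\<close>

definition faces :: "'a set set \<Rightarrow> 'a set set" where
  "faces C = insert {} C"

definition face_le :: "'a topology \<Rightarrow> 'a set \<Rightarrow> 'a set \<Rightarrow> bool" where
  "face_le X A B \<longleftrightarrow> X closure_of A \<subseteq> X closure_of B"

definition face_dim :: "'a topology \<Rightarrow> 'a set \<Rightarrow> int" where
  "face_dim X A = (if A = {} then -1 else int (cell_dim X A))"

definition boolean_lattice :: "'b set \<Rightarrow> ('b \<Rightarrow> 'b \<Rightarrow> bool) \<Rightarrow> bool" where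
  "boolean_lattice P le \<longleftrightarrow>
     (\<exists>(n::nat) g. bij_betw g P (Pow {..<n}) \<and> (\<forall>x\<in>P. \<forall>y\<in>P. le x y \<longleftrightarrow> g x \<subseteq> g y))"

text \<open>Finiteness of C is what makes the face numbers, hence the h-vector, meaningful.\<close>

definition boolean_cell_complex :: "'a topology \<Rightarrow> 'a set set \<Rightarrow> bool" where
  "boolean_cell_complex X C \<longleftrightarrow>
     regular_cw_complex X C \<and> finite C \<and>
     (\<forall>A\<in>faces C. boolean_lattice {B \<in> faces C. face_le X {} B \<and> face_le X B A} (face_le X))"

section \<open>Barycentric subdivision\<close>

text \<open>An abstract simplicial complex, given as the set of its faces (including the empty one).\<close>

definition sd :: "'a topology \<Rightarrow> 'a set set \<Rightarrow> 'a set set set" where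
  "sd X C = {c. finite c \<and> c \<subseteq> faces C - {{}} \<and>
                (\<forall>A\<in>c. \<forall>B\<in>c. face_le X A B \<or> face_le X B A)}"

definition simplex_dim :: "'v set \<Rightarrow> int" where
  "simplex_dim c = int (card c) - 1"

section \<open>Face numbers and h-vectors\<close>

text \<open>Both kinds of complexes are handled uniformly: F is the set of faces (including the empty
  face) and dm assigns to each face its dimension.\<close>

definition complex_dim :: "'f set \<Rightarrow> ('f \<Rightarrow> int) \<Rightarrow> int" where
  "complex_dim F dm = Max (dm ` F)"

definition f_number :: "'f set \<Rightarrow> ('f \<Rightarrow> int) \<Rightarrow> int \<Rightarrow> nat" where
  "f_number F dm i = card {A \<in> F. dm A = i}"

text \<open>With d - 1 the dimension of the complex, the j-th entry is the coefficient of t^(d-j) in the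
  sum over i of f_(i-1) (t-1)^(d-i).\<close>

definition h_number :: "'f set \<Rightarrow> ('f \<Rightarrow> int) \<Rightarrow> nat \<Rightarrow> int" where
  "h_number F dm j =
    (let d = nat (complex_dim F dm + 1)
     in if j \<le> d
        then coeff (\<Sum>i=0..d. smult (int (f_number F dm (int i - 1))) ([:-1, 1:] ^ (d - i))) (d - j)
        else 0)"

section \<open>Descents\<close>

definition des :: "nat \<Rightarrow> (nat \<Rightarrow> nat) \<Rightarrow> nat" where
  "des m \<sigma> = card {i \<in> {1..m-1}. \<sigma> i > \<sigma> (i + 1)}"

definition eulerian_A :: "nat \<Rightarrow> int \<Rightarrow> int \<Rightarrow> nat" where
  "eulerian_A m i j = card {\<sigma>. \<sigma> permutes {1..m} \<and> int (\<sigma> 1) = j \<and> int (des m \<sigma>) = i}"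

end

theory Submission
  imports "HOL-Homology.Invariance_of_Domain" Defs
begin

text \<open>Removing the top of a chain shows that the number of k-element chains of non-empty faces
  with top A depends only on the rank i of A; this gives the f-vector of the subdivision as
  a linear transform of the f-vector. Rewritten in terms of h-vectors, the coefficient of h_r is
  the polynomial that sums C(d-r, d-i) c(i,k) (t-1)^(d-k) over i and k, where c(i,k) is the chain
  count. It agrees with the sum of A(d+1,j,r+1) t^(d-j) over j, because both families P(d,r) satisfy
  P(d,r) - P(d,r+1) = (t-1) P(d-1,r) and P(d,d) = P(d-1,0) + ... + P(d-1,d-1); for permutations
  this is deletion of the first letter.

  The topological input is that the Boolean interval below a cell of dimension n has rank n+1.
  Dimensions drop strictly along proper faces, and invariance of domain produces a face of
  codimension one.\<close>

section \<open>Chain counts and refined Eulerian numbers\<close>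

text \<open>The subdivision sees only the order on the faces, while the f-vector is indexed by
  topological dimension. Nothing in the definitions ties the two together, and this forces the
  topological half of the proof. A CW-complex here only has the boundary of each cell covered by
  finitely many cells of smaller dimension: it is not given that this boundary is a union of cells,
  nor that some cell in it has codimension one. Once that is known, the Boolean rank of an interval
  is pinned down by induction: the strict drop of dimensions bounds it from above, a facet of
  codimension one bounds it from below.

  The binomial C(d-r, d-i) is the coefficient of h_r when f_(i-1) is recovered from the h-vector; it
  appears when t + 1 is substituted for t in the h-polynomial.\<close>

fun chain_count :: "nat \<Rightarrow> nat \<Rightarrow> nat" where
  "chain_count n 0 = (if n = 0 then 1 else 0)"
| "chain_count n (Suc k) = (\<Sum>i<n. (n choose i) * chain_count i k)"

declare chain_count.simps [simp del]

text \<open>\<open>chain_count n k\<close> counts the ordered partitions of an n-set into k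
  non-empty blocks (k! times a Stirling number of the second kind); in the recursion, i is the
  number of elements outside the last block.\<close>

lemma chain_count_eq_0: "n < k \<Longrightarrow> chain_count n k = 0"
proof (induction k arbitrary: n)
  case (Suc k)
  then show ?case by (auto simp: chain_count.simps)
qed simp

text \<open>The last summand of the recursion is already positive. This later yields a full chain
  below every face, so that subdividing does not lower the dimension.\<close>

lemma chain_count_self_pos: "chain_count n n > 0"
proof (induction n)
  case (Suc n)
  then show ?case
    by (auto simp: chain_count.simps(2) intro!: sum_pos2[of _ n])
qed (simp add: chain_count.simps)

section \<open>Deleting and restoring the first letter of a permutation\<close>

definition shift_up :: "nat \<Rightarrow> nat \<Rightarrow> nat" where
  "shift_up j x = (if x < j then x else Suc x)"

text \<open>Away from the value j this is the increasing inverse of \<open>shift_up j\<close>; it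
  standardises a word that avoids the letter j.\<close>

definition shift_down :: "nat \<Rightarrow> nat \<Rightarrow> nat" where
  "shift_down j x = (if x < j then x else x - 1)"

text \<open>In one-line notation: the letter j followed by the word of \<tau>, relabelled to avoid
  j. Positions outside the word stay fixed, as \<open>permutes\<close> demands.\<close>

definition prepend :: "nat \<Rightarrow> nat \<Rightarrow> (nat \<Rightarrow> nat) \<Rightarrow> nat \<Rightarrow> nat" where
  "prepend n j \<tau> i =
    (if i = 1 then j else if i \<in> {2..Suc n} then shift_up j (\<tau> (i - 1)) else i)"

definition behead :: "nat \<Rightarrow> nat \<Rightarrow> (nat \<Rightarrow> nat) \<Rightarrow> nat \<Rightarrow> nat" where
  "behead n j \<sigma> i = (if i \<in> {1..n} then shift_down j (\<sigma> (Suc i)) else i)"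

lemma shift_up_less_iff: "shift_up j x < shift_up j y \<longleftrightarrow> x < y"
  by (auto simp: shift_up_def)

lemma prepend_permutes:
  assumes "\<tau> permutes {1..n}" "j \<in> {1..Suc n}"
  shows "prepend n j \<tau> permutes {1..Suc n}"
proof (rule bij_imp_permutes)
  have "inj_on (prepend n j \<tau>) {1..Suc n}"
  proof (rule inj_onI)
    fix x y assume xy: "x \<in> {1..Suc n}" "y \<in> {1..Suc n}" "prepend n j \<tau> x = prepend n j \<tau> y"
    have *: "prepend n j \<tau> x = shift_up j (\<tau> (x - 1))" if "x \<in> {1..Suc n}" "x \<noteq> 1" for x
      using that by (simp add: prepend_def)
    \<comment> \<open>So position 1, which carries the letter j, cannot collide with another
      position.\<close>
    have ne: "shift_up j u \<noteq> j" for u by (simp add: shift_up_def)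
    show "x = y"
    proof (cases "x = 1 \<or> y = 1")
      case True
      then show ?thesis using xy *[of x] *[of y] ne by (metis prepend_def)
    next
      case False
      then have "\<tau> (x - 1) = \<tau> (y - 1)"
        using xy *[of x] *[of y] shift_up_less_iff[of j] by (metis nat_neq_iff)
      then have "x - 1 = y - 1"
        using assms(1) by (metis permutes_inverses(2))
      then show ?thesis using xy False by auto
    qed
  qed
  moreover have "prepend n j \<tau> ` {1..Suc n} \<subseteq> {1..Suc n}"
  proof
    fix y assume "y \<in> prepend n j \<tau> ` {1..Suc n}"
    then obtain i where i: "i \<in> {1..Suc n}" "y = prepend n j \<tau> i" by blast
    have "i \<noteq> 1 \<Longrightarrow> \<tau> (i - 1) \<in> {1..n}"
      using i(1) permutes_in_image[OF assms(1), of "i - 1"] by auto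
    then show "y \<in> {1..Suc n}"
      using i assms(2) by (auto simp: prepend_def shift_up_def)
  qed
  ultimately show "bij_betw (prepend n j \<tau>) {1..Suc n} {1..Suc n}"
    by (simp add: bij_betw_def endo_inj_surj)
qed (auto simp: prepend_def)

lemma behead_permutes:
  assumes "\<sigma> permutes {1..Suc n}" "\<sigma> 1 = j"
  shows "behead n j \<sigma> permutes {1..n}"
proof (rule bij_imp_permutes)
  have ne: "\<sigma> (Suc i) \<noteq> j" if "i \<ge> 1" for i
    using that assms by (metis Suc_n_not_le_n permutes_inverses(2))
  have j: "j \<in> {1..Suc n}" using assms permutes_in_image[OF assms(1), of 1] by auto
  have "inj_on (behead n j \<sigma>) {1..n}"
  proof (rule inj_onI)
    fix x y assume xy: "x \<in> {1..n}" "y \<in> {1..n}" "behead n j \<sigma> x = behead n j \<sigma> y"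
    have "\<sigma> (Suc x) = \<sigma> (Suc y)"
      using xy ne[of x] ne[of y] by (auto simp: behead_def shift_down_def split: if_splits)
    then show "x = y" using assms(1) by (metis permutes_inverses(2) Suc_inject)
  qed
  moreover have "behead n j \<sigma> ` {1..n} \<subseteq> {1..n}"
  proof
    fix y assume "y \<in> behead n j \<sigma> ` {1..n}"
    then obtain i where i: "i \<in> {1..n}" "y = behead n j \<sigma> i" by blast
    have "\<sigma> (Suc i) \<in> {1..Suc n}"
      using i(1) permutes_in_image[OF assms(1), of "Suc i"] by auto
    then show "y \<in> {1..n}"
      using i j ne[of i] by (auto simp: behead_def shift_down_def)
  qed
  ultimately show "bij_betw (behead n j \<sigma>) {1..n} {1..n}"
    by (simp add: bij_betw_def endo_inj_surj)
qed (auto simp: behead_def)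

lemma bij_betw_prepend:
  assumes j: "j \<in> {1..Suc n}"
  shows "bij_betw (prepend n j) {\<tau>. \<tau> permutes {1..n}} {\<sigma>. \<sigma> permutes {1..Suc n} \<and> \<sigma> 1 = j}"
proof (rule bij_betw_byWitness[where f' = "behead n j"])
  show "\<forall>\<tau>\<in>{\<tau>. \<tau> permutes {1..n}}. behead n j (prepend n j \<tau>) = \<tau>"
  proof (intro ballI ext, elim CollectE)
    fix \<tau> i assume "\<tau> permutes {1..n}"
    then have "i \<notin> {1..n} \<Longrightarrow> \<tau> i = i" by (meson permutes_not_in)
    moreover have "shift_down j (shift_up j x) = x" for x
      by (auto simp: shift_up_def shift_down_def)
    ultimately show "behead n j (prepend n j \<tau>) i = \<tau> i"
      by (auto simp: behead_def prepend_def)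
  qed
  show "\<forall>\<sigma>\<in>{\<sigma>. \<sigma> permutes {1..Suc n} \<and> \<sigma> 1 = j}. prepend n j (behead n j \<sigma>) = \<sigma>"
  proof (intro ballI ext, elim CollectE conjE)
    fix \<sigma> i assume s: "\<sigma> permutes {1..Suc n}" "\<sigma> 1 = j"
    have ne: "\<sigma> i \<noteq> j" if "i \<noteq> 1"
      using that s by (metis permutes_inverses(2))
    have "i \<notin> {1..Suc n} \<Longrightarrow> \<sigma> i = i" using s(1) by (meson permutes_not_in)
    moreover have "shift_up j (shift_down j x) = x" if "x \<noteq> j" for x
      using that by (auto simp: shift_up_def shift_down_def)
    moreover have "i \<in> {2..Suc n} \<Longrightarrow> i \<noteq> 1 \<and> i - 1 \<in> {1..n} \<and> Suc (i - 1) = i" by auto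
    ultimately show "prepend n j (behead n j \<sigma>) i = \<sigma> i"
      using ne s(2) by (cases "i = 1"; cases "i \<in> {2..Suc n}") (auto simp: behead_def prepend_def)
  qed
  show "prepend n j ` {\<tau>. \<tau> permutes {1..n}} \<subseteq> {\<sigma>. \<sigma> permutes {1..Suc n} \<and> \<sigma> 1 = j}"
    using prepend_permutes j by (auto simp: prepend_def)
  show "behead n j ` {\<sigma>. \<sigma> permutes {1..Suc n} \<and> \<sigma> 1 = j} \<subseteq> {\<tau>. \<tau> permutes {1..n}}"
    using behead_permutes by auto
qed

text \<open>Relabelling preserves order, so the descents of \<tau> just move one place to the right.
  The only new adjacent pair is j and the relabelled \<tau> 1, which is below j exactly when \<tau>
  1 itself is.\<close>

lemma des_prepend:
  assumes "n \<ge> 1"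
  shows "des (Suc n) (prepend n j \<tau>) = des n \<tau> + (if \<tau> 1 < j then 1 else 0)"
proof -
  let ?s = "prepend n j \<tau>"
  let ?D = "{i \<in> {1..n-1}. \<tau> i > \<tau> (i + 1)}"
  have "{i \<in> {1..n}. ?s i > ?s (i + 1)} = (if \<tau> 1 < j then {1} else {}) \<union> Suc ` ?D"
  proof (rule Set.set_eqI)
    fix i
    consider "i = 0" | "i = 1" | k where "i = Suc k" "k \<ge> 1"
      by (metis One_nat_def Suc_leI not0_implies_Suc not_gr_zero)
    then show "i \<in> {i \<in> {1..n}. ?s i > ?s (i + 1)} \<longleftrightarrow>
        i \<in> (if \<tau> 1 < j then {1} else {}) \<union> Suc ` ?D"
    proof cases
      case 2
      then show ?thesis using assms by (auto simp: prepend_def shift_up_def)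
    next
      case 3
      then show ?thesis by (auto simp: prepend_def shift_up_less_iff)
    qed auto
  qed
  moreover have "card ((if \<tau> 1 < j then {1} else {}) \<union> Suc ` ?D) =
      (if \<tau> 1 < j then 1 else 0) + card (Suc ` ?D)"
    by (subst card_Un_disjoint) auto
  ultimately show ?thesis
    by (simp add: des_def card_image)
qed

text \<open>These zeros absorb the extreme terms when sums over the number of descents are shifted
  by one; the integer index lets i - 1 leave the range at i = 0.\<close>

lemma eulerian_A_eq_0:
  "i < 0 \<Longrightarrow> eulerian_A m i j = 0"
  "i \<ge> int m \<Longrightarrow> m \<ge> 1 \<Longrightarrow> eulerian_A m i j = 0"
proof -
  show "i < 0 \<Longrightarrow> eulerian_A m i j = 0"
    by (auto simp: eulerian_A_def)
  have *: "des m \<sigma> \<le> m - 1" for \<sigma>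
    unfolding des_def by (rule order_trans[OF card_mono[of "{1..m-1}"]]) auto
  have "{\<sigma>. \<sigma> permutes {1..m} \<and> int (\<sigma> 1) = j \<and> int (des m \<sigma>) = i} = {}"
    if "i \<ge> int m" "m \<ge> 1"
  proof -
    have "int (des m \<sigma>) \<noteq> i" for \<sigma>
      using that *[of \<sigma>] by linarith
    then show ?thesis by simp
  qed
  then show "i \<ge> int m \<Longrightarrow> m \<ge> 1 \<Longrightarrow> eulerian_A m i j = 0"
    by (simp only: eulerian_A_def card.empty)
qed

lemma card_Collect_bij_betw:
  assumes "bij_betw f A B"
  shows "card {a \<in> A. P (f a)} = card {b \<in> B. P b}"
proof -
  have "bij_betw f {a \<in> A. P (f a)} {b \<in> B. P b}"
    using assms by (auto simp: bij_betw_def inj_on_def)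
  then show ?thesis by (rule bij_betw_same_card)
qed

text \<open>Sort by the first letter l of the word left after deleting j: a descent is lost with j
  exactly when l < j.\<close>

lemma eulerian_A_Suc:
  assumes n: "n \<ge> 1" and j: "j \<in> {1..Suc n}"
  shows "eulerian_A (Suc n) i (int j) =
    (\<Sum>l=1..n. eulerian_A n (if l < j then i - 1 else i) (int l))"
proof -
  let ?P = "\<lambda>l. {\<tau>. \<tau> permutes {1..n} \<and> int (\<tau> 1) = int l \<and> int (des n \<tau>) = (if l < j then i - 1 else i)}"
  have "{\<sigma>. \<sigma> permutes {1..Suc n} \<and> int (\<sigma> 1) = int j \<and> int (des (Suc n) \<sigma>) = i}
     = {\<sigma>\<in>{\<sigma>. \<sigma> permutes {1..Suc n} \<and> \<sigma> 1 = j}. int (des (Suc n) \<sigma>) = i}" by auto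
  also have "card \<dots> = card {\<tau>\<in>{\<tau>. \<tau> permutes {1..n}}. int (des (Suc n) (prepend n j \<tau>)) = i}"
    by (rule card_Collect_bij_betw[OF bij_betw_prepend[OF j], symmetric])
  also have "{\<tau>\<in>{\<tau>. \<tau> permutes {1..n}}. int (des (Suc n) (prepend n j \<tau>)) = i} = (\<Union>l\<in>{1..n}. ?P l)"
  proof -
    have "\<tau> permutes {1..n} \<Longrightarrow> \<tau> 1 \<in> {1..n}" for \<tau>
      using permutes_in_image[of \<tau> "{1..n}" 1] n by auto
    then show ?thesis using n by (auto simp: des_prepend)
  qed
  also have "card \<dots> = (\<Sum>l=1..n. card (?P l))"
    by (rule card_UN_disjoint) (auto intro: finite_subset[OF _ finite_permutations[of "{1..n}"]])
  finally show ?thesis by (simp add: eulerian_A_def)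
qed

section \<open>Two polynomial families with a common recurrence\<close>

definition eulerian_poly :: "nat \<Rightarrow> nat \<Rightarrow> int poly" where
  "eulerian_poly d r = (\<Sum>j\<le>d. monom (int (eulerian_A (d + 1) (int j) (int r + 1))) (d - j))"

text \<open>The contribution of the chains topped by one fixed face of rank i to the h-polynomial of
  the subdivision.\<close>

definition chain_poly :: "nat \<Rightarrow> nat \<Rightarrow> int poly" where
  "chain_poly d i = (\<Sum>k\<le>d. smult (int (chain_count i k)) ([:-1, 1:] ^ (d - k)))"

text \<open>The coefficient of h_r in the h-polynomial of the subdivision, once the f-vector has
  been expressed through the h-vector.\<close>

definition chain_sum :: "nat \<Rightarrow> nat \<Rightarrow> int poly" where
  "chain_sum d r = (\<Sum>i\<le>d. smult (int ((d - r) choose (d - i))) (chain_poly d i))"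

text \<open>Raising the first letter from j to j + 1 affects a single summand of
  \<open>eulerian_A_Suc\<close>, the one with l = j, where the front pair becomes a descent.\<close>

lemma eulerian_A_diff:
  assumes n: "n \<ge> 1" and j: "j \<in> {1..n}"
  shows "int (eulerian_A (Suc n) i (int j)) - int (eulerian_A (Suc n) i (int (Suc j))) =
    int (eulerian_A n i (int j)) - int (eulerian_A n (i - 1) (int j))"
proof -
  have "int (eulerian_A (Suc n) i (int j)) - int (eulerian_A (Suc n) i (int (Suc j)))
     = (\<Sum>l=1..n. int (eulerian_A n (if l < j then i - 1 else i) (int l)) -
           int (eulerian_A n (if l < Suc j then i - 1 else i) (int l)))"
    using j by (subst (1 2) eulerian_A_Suc) (use n in \<open>auto simp: sum_subtractf\<close>)
  also have "\<dots> = (\<Sum>l=1..n. if l = j then int (eulerian_A n i (int j)) - int (eulerian_A n (i - 1) (int j)) else 0)"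
    by (rule sum.cong) auto
  also have "\<dots> = int (eulerian_A n i (int j)) - int (eulerian_A n (i - 1) (int j))"
    using j by simp
  finally show ?thesis .
qed

text \<open>Raising the exponent from d - j to Suc d - j costs a factor t, which lowering the
  descent index by one compensates. The extra terms, j = Suc d in the first sum and j = 0 in the
  second, vanish.\<close>

lemma eulerian_poly_shift:
  "(\<Sum>j\<le>Suc d. monom (int (eulerian_A (Suc d) (int j) (int r + 1))) (Suc d - j)) =
     [:0, 1:] * eulerian_poly d r" (is ?thesis1)
  "(\<Sum>j\<le>Suc d. monom (int (eulerian_A (Suc d) (int j - 1) (int r + 1))) (Suc d - j)) =
     eulerian_poly d r" (is ?thesis2)
proof -
  have "(\<Sum>j\<le>Suc d. monom (int (eulerian_A (Suc d) (int j) (int r + 1))) (Suc d - j)) =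
     (\<Sum>j\<le>d. monom (int (eulerian_A (Suc d) (int j) (int r + 1))) (Suc d - j))"
    by (simp add: eulerian_A_eq_0(2))
  also have "\<dots> = (\<Sum>j\<le>d. [:0, 1:] * monom (int (eulerian_A (Suc d) (int j) (int r + 1))) (d - j))"
    by (rule sum.cong) (auto simp: Suc_diff_le monom_Suc)
  finally show ?thesis1 by (simp add: eulerian_poly_def sum_distrib_left)
  show ?thesis2
    by (subst sum.atMost_Suc_shift) (simp add: eulerian_A_eq_0(1) eulerian_poly_def)
qed

text \<open>On the right of \<open>eulerian_A_diff\<close> the term with i contributes the factor t
  and the term with i - 1 the factor 1, whence t - 1.\<close>

lemma eulerian_poly_Suc:
  assumes "r \<le> d"
  shows "eulerian_poly (Suc d) r = eulerian_poly (Suc d) (Suc r) + [:-1, 1:] * eulerian_poly d r"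
proof -
  have *: "int (eulerian_A (Suc (Suc d)) (int j) (int r + 1)) =
     int (eulerian_A (Suc (Suc d)) (int j) (int (Suc r) + 1)) +
     (int (eulerian_A (Suc d) (int j) (int r + 1)) - int (eulerian_A (Suc d) (int j - 1) (int r + 1)))" for j
    using eulerian_A_diff[of "Suc d" "Suc r" "int j"] assms by (simp add: algebra_simps)
  have "eulerian_poly (Suc d) r = eulerian_poly (Suc d) (Suc r) +
     ([:0, 1:] * eulerian_poly d r - eulerian_poly d r)"
    unfolding eulerian_poly_shift(1)[symmetric] eulerian_poly_def[of "Suc d"] Suc_eq_plus1[symmetric] *
    by (simp only: add_monom[symmetric] diff_monom[symmetric] sum.distrib sum_subtractf eulerian_poly_shift(2))
  also have "[:0, 1:] * eulerian_poly d r - eulerian_poly d r = [:-1, 1:] * eulerian_poly d r"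
    by simp
  finally show ?thesis .
qed

text \<open>A permutation that starts with its largest letter has a descent at the front whatever
  follows, so deletion lowers the descent number by exactly one.\<close>

lemma eulerian_poly_Suc_Suc:
  "eulerian_poly (Suc d) (Suc d) = (\<Sum>r\<le>d. eulerian_poly d r)"
proof -
  have *: "int (eulerian_A (Suc (Suc d)) (int j) (int (Suc d) + 1)) =
      (\<Sum>r\<le>d. int (eulerian_A (Suc d) (int j - 1) (int r + 1)))" for j
  proof -
    have "eulerian_A (Suc (Suc d)) (int j) (int (Suc (Suc d))) =
       (\<Sum>l=1..Suc d. eulerian_A (Suc d) (int j - 1) (int l))"
      by (subst eulerian_A_Suc) auto
    also have "\<dots> = (\<Sum>r\<le>d. eulerian_A (Suc d) (int j - 1) (int (Suc r)))"
      by (rule sum.reindex_bij_witness[of _ Suc "\<lambda>l. l - 1"]) auto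
    finally show ?thesis by (simp add: algebra_simps)
  qed
  have "monom (\<Sum>r\<le>d. f r) k = (\<Sum>r\<le>d. monom (f r) k)" for f :: "nat \<Rightarrow> int" and k
    by (induction d) (auto simp: add_monom[symmetric])
  then have "eulerian_poly (Suc d) (Suc d) =
     (\<Sum>r\<le>d. \<Sum>j\<le>Suc d. monom (int (eulerian_A (Suc d) (int j - 1) (int r + 1))) (Suc d - j))"
    unfolding eulerian_poly_def Suc_eq_plus1[symmetric] *
    by (subst sum.swap) simp
  then show ?thesis by (simp only: eulerian_poly_shift)
qed

text \<open>For i \<le> d the term k = Suc d is zero, and every other power gains one
  factor.\<close>

lemma chain_poly_Suc:
  assumes "i \<le> d" shows "chain_poly (Suc d) i = [:-1, 1:] * chain_poly d i"
proof -
  have "chain_poly (Suc d) i = (\<Sum>k\<le>d. smult (int (chain_count i k)) ([:-1, 1:] ^ (Suc d - k)))"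
    using assms by (simp add: chain_poly_def chain_count_eq_0)
  also have "\<dots> = (\<Sum>k\<le>d. [:-1, 1:] * smult (int (chain_count i k)) ([:-1, 1:] ^ (d - k)))"
    by (rule sum.cong) (auto simp: Suc_diff_le)
  finally show ?thesis by (simp add: chain_poly_def sum_distrib_left)
qed

text \<open>Pascal's rule splits the binomial. One part is the sum for Suc r; in the other, i stays
  at most d and \<open>chain_poly_Suc\<close> releases the factor t - 1.\<close>

lemma chain_sum_Suc:
  assumes "r \<le> d"
  shows "chain_sum (Suc d) r = chain_sum (Suc d) (Suc r) + [:-1, 1:] * chain_sum d r"
proof -
  \<comment> \<open>The conditional is essential at i = Suc d: truncated subtraction would turn d -
    i into 0 and the binomial into 1.\<close>
  have *: "(Suc d - r) choose (Suc d - i) =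
      (if i \<le> d then (d - r) choose (d - i) else 0) + ((d - r) choose (Suc d - i))"
    if "i \<le> Suc d" for i
  proof (cases "i \<le> d")
    case True
    then show ?thesis using assms by (simp add: Suc_diff_le)
  next
    case False
    then have "i = Suc d" using that by simp
    then show ?thesis by simp
  qed
  have "chain_sum (Suc d) r = (\<Sum>i\<le>Suc d. smult (int ((d - r) choose (Suc d - i))) (chain_poly (Suc d) i) +
     (if i \<le> d then smult (int ((d - r) choose (d - i))) (chain_poly (Suc d) i) else 0))"
    unfolding chain_sum_def by (rule sum.cong) (auto simp: * smult_add_left)
  also have "\<dots> = chain_sum (Suc d) (Suc r) + (\<Sum>i\<le>d. smult (int ((d - r) choose (d - i))) (chain_poly (Suc d) i))"
    by (simp add: sum.distrib chain_sum_def)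
  also have "(\<Sum>i\<le>d. smult (int ((d - r) choose (d - i))) (chain_poly (Suc d) i)) = [:-1, 1:] * chain_sum d r"
    unfolding chain_sum_def sum_distrib_left by (rule sum.cong) (auto simp: chain_poly_Suc)
  finally show ?thesis .
qed

text \<open>Reversing r turns this into the hockey-stick identity.\<close>

lemma sum_choose_diff:
  assumes "i \<le> d" shows "(\<Sum>r\<le>d. (d - r) choose (d - i)) = Suc d choose i"
proof -
  have "(\<Sum>r\<le>d. (d - r) choose (d - i)) = (\<Sum>r\<le>d. r choose (d - i))"
    by (rule sum.reindex_bij_witness[of _ "\<lambda>r. d - r" "\<lambda>r. d - r"]) auto
  also have "\<dots> = Suc d choose Suc (d - i)"
    using sum_choose_upper[of "d - i" d] by (simp add: atMost_atLeast0)
  also have "\<dots> = Suc d choose i"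
    using assms by (metis Suc_diff_le binomial_symmetric le_SucI)
  finally show ?thesis .
qed

lemma smult_sum_right: "smult c (\<Sum>i\<in>S. f i) = (\<Sum>i\<in>S. smult c (f i))"
  by (induction S rule: infinite_finite_induct) (auto simp: smult_add_right)

text \<open>For r = Suc d only i = Suc d survives. The recursion for chains then introduces C(d+1,
  i), which the hockey-stick identity spreads over all r \<le> d.\<close>

lemma chain_sum_Suc_Suc:
  "chain_sum (Suc d) (Suc d) = (\<Sum>r\<le>d. chain_sum d r)"
proof -
  have "chain_sum (Suc d) (Suc d) = chain_poly (Suc d) (Suc d)"
    unfolding chain_sum_def by (simp add: Suc_diff_le)
  also have "\<dots> = (\<Sum>k\<le>d. smult (int (chain_count (Suc d) (Suc k))) ([:-1, 1:] ^ (d - k)))"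
    unfolding chain_poly_def by (subst sum.atMost_Suc_shift) (simp add: chain_count.simps(1))
  also have "\<dots> = (\<Sum>k\<le>d. \<Sum>i\<le>d. smult (int (Suc d choose i)) (smult (int (chain_count i k)) ([:-1, 1:] ^ (d - k))))"
    by (simp add: chain_count.simps(2) lessThan_Suc_atMost smult_sum del: binomial_Suc_Suc)
  also have "\<dots> = (\<Sum>i\<le>d. smult (int (Suc d choose i)) (chain_poly d i))"
    unfolding chain_poly_def smult_sum_right by (rule sum.swap)
  also have "\<dots> = (\<Sum>i\<le>d. \<Sum>r\<le>d. smult (int ((d - r) choose (d - i))) (chain_poly d i))"
    by (rule sum.cong) (auto simp: sum_choose_diff[symmetric] smult_sum)
  also have "\<dots> = (\<Sum>r\<le>d. chain_sum d r)"
    by (subst sum.swap) (simp add: chain_sum_def)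
  finally show ?thesis .
qed

lemma eulerian_A_1: "eulerian_A 1 0 1 = 1"
proof -
  have "{\<sigma>. \<sigma> permutes {1..1::nat} \<and> int (\<sigma> 1) = 1 \<and> int (des 1 \<sigma>) = 0} = {id}"
    by (auto simp: des_def)
  then show ?thesis by (simp add: eulerian_A_def)
qed

text \<open>Only the case r = Suc d reaches dimension Suc d directly from dimension d, so the inner
  induction starts there and descends in r.\<close>

lemma chain_sum_eq_eulerian_poly:
  "r \<le> d \<Longrightarrow> chain_sum d r = eulerian_poly d r"
proof (induction d arbitrary: r)
  case 0
  then show ?case
    using eulerian_A_1 by (simp add: chain_sum_def chain_poly_def eulerian_poly_def chain_count.simps monom_0)
next
  case (Suc d)
  show ?case using Suc.prems
  proof (induction r rule: inc_induct)
    case base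
    show ?case by (simp add: chain_sum_Suc_Suc eulerian_poly_Suc_Suc Suc.IH)
  next
    case (step r)
    then show ?case by (simp add: chain_sum_Suc eulerian_poly_Suc Suc.IH del: mult_pCons_left)
  qed
qed

section \<open>The transformation of h-vectors\<close>

text \<open>When f i counts the faces of dimension i - 1, the coefficient of t^(d-r) is h_r.\<close>

definition h_poly :: "nat \<Rightarrow> (nat \<Rightarrow> int) \<Rightarrow> int poly" where
  "h_poly d f = (\<Sum>i\<le>d. smult (f i) ([:-1, 1:] ^ (d - i)))"

lemma degree_h_poly: "degree (h_poly d f) \<le> d"
  unfolding h_poly_def
proof (rule degree_sum_le)
  fix i
  have "degree ([:-1, 1:] ^ (d - i) :: int poly) \<le> d - i"
    using degree_power_le[of "[:-1, 1:] :: int poly" "d - i"] by simp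
  then show "degree (smult (f i) ([:-1, 1:] ^ (d - i))) \<le> d"
    using degree_smult_le[of "f i" "[:-1, 1:] ^ (d - i)"] by linarith
qed simp

lemma pcompose_power: "(p ^ n) \<circ>\<^sub>p q = (p \<circ>\<^sub>p q) ^ n" for p q :: "'a::comm_semiring_1 poly"
  by (induction n) (auto simp: pcompose_mult pcompose_1)

lemma coeff_one_plus_X_power: "coeff ([:1, 1:] ^ n :: int poly) i = int (n choose i)"
proof (cases "i \<le> n")
  case True
  then show ?thesis by (simp add: coeff_linear_poly_power)
next
  case False
  then have "degree ([:1, 1:] ^ n :: int poly) < i"
    using degree_power_le[of "[:1, 1:] :: int poly" n] by simp
  then show ?thesis using False by (simp add: coeff_eq_0)
qed

text \<open>Substituting t + 1 for t turns the powers of t - 1 into powers of t, so the values f i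
  become coefficients; expanding the powers of t + 1 on the h-side produces the binomials.\<close>

lemma f_eq_sum_h:
  assumes "i \<le> d"
  shows "f i = (\<Sum>r\<le>d. coeff (h_poly d f) (d - r) * int ((d - r) choose (d - i)))"
proof -
  have "h_poly d f \<circ>\<^sub>p [:1, 1:] = (\<Sum>i\<le>d. monom (f i) (d - i))"
    unfolding h_poly_def pcompose_sum
    by (rule sum.cong) (auto simp: pcompose_smult pcompose_power pcompose_pCons monom_altdef)
  then have "coeff (h_poly d f \<circ>\<^sub>p [:1, 1:]) (d - i) = (\<Sum>r\<le>d. if r = i then f i else 0)"
    using assms by (simp only: coeff_sum coeff_monom) (intro sum.cong, auto)
  then have 1: "coeff (h_poly d f \<circ>\<^sub>p [:1, 1:]) (d - i) = f i"
    using assms by simp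
  \<comment> \<open>The degree bound stops this sum at d, so that r can be replaced by d - r at the
    end.\<close>
  have "h_poly d f = (\<Sum>r\<le>d. smult (coeff (h_poly d f) r) ([:0, 1:] ^ r))"
    using poly_as_sum_of_monoms'[OF degree_h_poly[of d f]] by (simp add: monom_altdef)
  then have "h_poly d f \<circ>\<^sub>p [:1, 1:] = (\<Sum>r\<le>d. smult (coeff (h_poly d f) r) ([:0, 1:] ^ r)) \<circ>\<^sub>p [:1, 1:]"
    by simp
  also have "\<dots> = (\<Sum>r\<le>d. smult (coeff (h_poly d f) r) ([:1, 1:] ^ r))"
    unfolding pcompose_sum by (simp add: pcompose_smult pcompose_power pcompose_pCons)
  finally have "f i = (\<Sum>r\<le>d. coeff (h_poly d f) r * int (r choose (d - i)))"
    using 1 by (simp add: coeff_sum coeff_one_plus_X_power)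
  also have "\<dots> = (\<Sum>r\<le>d. coeff (h_poly d f) (d - r) * int ((d - r) choose (d - i)))"
    by (rule sum.reindex_bij_witness[of _ "\<lambda>r. d - r" "\<lambda>r. d - r"]) auto
  finally show ?thesis .
qed

lemma h_poly_subdivision:
  assumes "\<And>k. k \<le> d \<Longrightarrow> g k = (\<Sum>i\<le>d. f i * int (chain_count i k))" and "j \<le> d"
  shows "coeff (h_poly d g) (d - j) =
    (\<Sum>r\<le>d. int (eulerian_A (d + 1) (int j) (int r + 1)) * coeff (h_poly d f) (d - r))"
proof -
  have "h_poly d g = (\<Sum>k\<le>d. \<Sum>i\<le>d. smult (f i) (smult (int (chain_count i k)) ([:-1, 1:] ^ (d - k))))"
    unfolding h_poly_def by (rule sum.cong) (auto simp: assms(1) smult_sum)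
  also have "\<dots> = (\<Sum>i\<le>d. smult (f i) (chain_poly d i))"
    unfolding chain_poly_def smult_sum_right by (rule sum.swap)
  \<comment> \<open>The f-vector is traded for the h-vector here; exchanging the sums then collects
    \<open>chain_sum d r\<close> as the coefficient of h_r.\<close>
  also have "\<dots> = (\<Sum>i\<le>d. \<Sum>r\<le>d. smult (coeff (h_poly d f) (d - r))
      (smult (int ((d - r) choose (d - i))) (chain_poly d i)))"
    by (rule sum.cong, simp, subst f_eq_sum_h[of _ d f]) (auto simp: smult_sum)
  also have "\<dots> = (\<Sum>r\<le>d. smult (coeff (h_poly d f) (d - r)) (chain_sum d r))"
    unfolding chain_sum_def smult_sum_right by (rule sum.swap)
  also have "\<dots> = (\<Sum>r\<le>d. smult (coeff (h_poly d f) (d - r)) (eulerian_poly d r))"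
    by (simp add: chain_sum_eq_eulerian_poly)
  finally have "coeff (h_poly d g) (d - j) =
      (\<Sum>r\<le>d. coeff (h_poly d f) (d - r) * coeff (eulerian_poly d r) (d - j))"
    by (simp add: coeff_sum)
  moreover have "coeff (eulerian_poly d r) (d - j) = int (eulerian_A (d + 1) (int j) (int r + 1))" for r
  proof -
    have "coeff (eulerian_poly d r) (d - j) =
        (\<Sum>k\<le>d. if k = j then int (eulerian_A (d + 1) (int j) (int r + 1)) else 0)"
      unfolding eulerian_poly_def coeff_sum using assms(2) by (intro sum.cong) auto
    then show ?thesis using assms(2) by simp
  qed
  ultimately show ?thesis by (simp add: mult.commute)
qed

section \<open>Chains in Boolean posets\<close>

text \<open>The rank is a parameter rather than derived from the order because for faces it has to
  be the topological one; \<open>interval\<close> is the bridge between the two.\<close>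

locale boolean_poset =
  fixes P :: "'b set" and le :: "'b \<Rightarrow> 'b \<Rightarrow> bool" and bot :: 'b and rk :: "'b \<Rightarrow> nat"
  assumes fin: "finite P"
    and bot: "bot \<in> P" "\<And>A. A \<in> P \<Longrightarrow> le bot A"
    and refl: "\<And>A. A \<in> P \<Longrightarrow> le A A"
    and trans: "\<And>A B C. A \<in> P \<Longrightarrow> B \<in> P \<Longrightarrow> C \<in> P \<Longrightarrow> le A B \<Longrightarrow> le B C \<Longrightarrow> le A C"
    and antisym: "\<And>A B. A \<in> P \<Longrightarrow> B \<in> P \<Longrightarrow> le A B \<Longrightarrow> le B A \<Longrightarrow> A = B"
    and interval: "\<And>A. A \<in> P \<Longrightarrow> \<exists>g. bij_betw g {B \<in> P. le B A} (Pow {..<rk A}) \<and>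
      (\<forall>x\<in>{B \<in> P. le B A}. \<forall>y\<in>{B \<in> P. le B A}. le x y \<longleftrightarrow> g x \<subseteq> g y)"
begin

lemma card_interval:
  assumes "A \<in> P" shows "card {B \<in> P. le B A} = 2 ^ rk A"
proof -
  obtain g where "bij_betw g {B \<in> P. le B A} (Pow {..<rk A})"
    using interval[OF assms] by blast
  then show ?thesis by (simp add: bij_betw_same_card card_Pow)
qed

text \<open>The interval below B is a proper subset of the one below A, and their sizes are powers
  of 2 with the ranks as exponents.\<close>

lemma rk_less:
  assumes "A \<in> P" "B \<in> P" "le B A" "B \<noteq> A" shows "rk B < rk A"
proof -
  have "{C \<in> P. le C B} \<subseteq> {C \<in> P. le C A}" using assms trans by blast
  moreover have "A \<in> {C \<in> P. le C A} - {C \<in> P. le C B}" using assms antisym refl by blast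
  ultimately have "card {C \<in> P. le C B} < card {C \<in> P. le C A}"
    using fin by (intro psubset_card_mono) auto
  then show ?thesis using assms by (simp add: card_interval)
qed

lemma rk_bot: "rk bot = 0"
proof -
  have "{B \<in> P. le B bot} = {bot}" using bot antisym by blast
  then have "2 ^ rk bot = (1::nat)" using card_interval[OF bot(1)] by simp
  then show ?thesis by simp
qed

lemma rk_eq_0_iff: "A \<in> P \<Longrightarrow> rk A = 0 \<longleftrightarrow> A = bot"
  using rk_bot rk_less[of A bot] bot by (metis not_less0)

text \<open>Elements of rank i should match the i-subsets, but \<open>interval\<close> gives B an
  isomorphism of its own, unrelated to g. Counting the interval below B in both ways identifies its
  rank with the size of g B.\<close>

lemma card_interval_rank:
  assumes "A \<in> P" shows "card {B \<in> P. le B A \<and> rk B = i} = rk A choose i"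
proof -
  obtain g where g: "bij_betw g {B \<in> P. le B A} (Pow {..<rk A})"
    and mono: "\<And>x y. x \<in> {B \<in> P. le B A} \<Longrightarrow> y \<in> {B \<in> P. le B A} \<Longrightarrow> le x y \<longleftrightarrow> g x \<subseteq> g y"
    using interval[OF assms] by blast
  have rk: "rk B = card (g B)" if B: "B \<in> {B \<in> P. le B A}" for B
  proof -
    have sub: "g B \<subseteq> {..<rk A}" using g B by (auto simp: bij_betw_def)
    have "bij_betw g {C \<in> P. le C B} (Pow (g B))"
    proof (rule bij_betw_subset[OF g])
      show "{C \<in> P. le C B} \<subseteq> {C \<in> P. le C A}" using B assms trans by blast
      show "g ` {C \<in> P. le C B} = Pow (g B)"
      proof (intro equalityI subsetI)
        fix S assume "S \<in> Pow (g B)"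
        then have "S \<in> g ` {B \<in> P. le B A}" "S \<subseteq> g B" using sub g by (auto simp: bij_betw_def)
        then show "S \<in> g ` {C \<in> P. le C B}" using mono B by blast
      next
        fix S assume "S \<in> g ` {C \<in> P. le C B}"
        then obtain C where C: "C \<in> P" "le C B" "S = g C" by blast
        then have "le C A" using B assms trans by blast
        then show "S \<in> Pow (g B)" using mono[of C B] C B by blast
      qed
    qed
    then have "card {C \<in> P. le C B} = 2 ^ card (g B)"
      using sub by (metis bij_betw_same_card card_Pow finite_lessThan finite_subset)
    then show ?thesis using card_interval[of B] B by simp
  qed
  have "{B \<in> P. le B A \<and> rk B = i} = {B \<in> {B \<in> P. le B A}. card (g B) = i}"
    using rk by auto
  also have "card \<dots> = card {S \<in> Pow {..<rk A}. card S = i}"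
    by (rule card_Collect_bij_betw[OF g])
  also have "\<dots> = rk A choose i"
    using n_subsets[of "{..<rk A}" i] by (simp add: Pow_def)
  finally show ?thesis .
qed

section \<open>Counting chains by their top element\<close>

definition chain :: "'b set \<Rightarrow> bool" where
  "chain c \<longleftrightarrow> c \<subseteq> P - {bot} \<and> (\<forall>A\<in>c. \<forall>B\<in>c. le A B \<or> le B A)"

text \<open>The bottom element serves as the top of the empty chain.\<close>

definition chains_below :: "nat \<Rightarrow> 'b \<Rightarrow> 'b set set" where
  "chains_below k A = {c. chain c \<and> card c = k \<and> (\<forall>B\<in>c. le B A) \<and> (A = bot \<or> A \<in> c)}"

lemma chain_finite: "chain c \<Longrightarrow> finite c"
  using fin by (auto simp: chain_def intro: finite_subset)

text \<open>An element of largest rank is the top: a member not below it would be comparable from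
  above and have larger rank.\<close>

lemma chain_top:
  assumes "chain c"
  shows "\<exists>A\<in>P. (\<forall>B\<in>c. le B A) \<and> (A = bot \<and> c = {} \<or> A \<in> c)"
proof (cases "c = {}")
  case True
  then show ?thesis using bot by auto
next
  case False
  have "Max (rk ` c) \<in> rk ` c" using False chain_finite[OF assms] by simp
  then obtain A where A: "A \<in> c" "rk A = Max (rk ` c)" by auto
  have "le B A" if "B \<in> c" for B
  proof (rule ccontr)
    assume *: "\<not> le B A"
    have "A \<in> P" "B \<in> P" "le A B" using assms A(1) that * by (auto simp: chain_def)
    moreover have "A \<noteq> B" using * refl \<open>B \<in> P\<close> by auto
    ultimately have "rk A < rk B" using rk_less by blast
    moreover have "rk B \<le> rk A" using A(2) that chain_finite[OF assms] by simp
    ultimately show False by simp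
  qed
  then show ?thesis using A(1) assms by (auto simp: chain_def)
qed

text \<open>A chain determines its top, so a sum over tops counts no chain twice.\<close>

lemma chains_below_disjoint:
  assumes "A \<in> P" "B \<in> P" "c \<in> chains_below k A" "c \<in> chains_below l B" shows "A = B"
proof -
  have *: "D = bot" if "C = bot" "C \<in> P" "D \<in> P" "c \<in> chains_below k C" "c \<in> chains_below l D" for C D k l
    using that antisym bot by (auto simp: chains_below_def)
  show ?thesis
  proof (cases "A = bot \<or> B = bot")
    case True
    then show ?thesis using * assms by metis
  next
    case False
    then show ?thesis using assms antisym by (auto simp: chains_below_def)
  qed
qed

lemma finite_chains_below: "finite (chains_below k A)"
  by (rule finite_subset[of _ "Pow P"]) (use fin in \<open>auto simp: chains_below_def chain_def\<close>)

text \<open>B is the top of what remains without A. The value B = bot accounts for the one-element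
  chain {A}, which leaves the empty chain.\<close>

lemma chains_below_Suc:
  assumes A: "A \<in> P" "A \<noteq> bot"
  shows "bij_betw (insert A) (\<Union>B\<in>{B \<in> P. le B A \<and> B \<noteq> A}. chains_below k B) (chains_below (Suc k) A)"
proof -
  have notin: "A \<notin> c" if "B \<in> P" "le B A" "B \<noteq> A" "c \<in> chains_below k B" for B c
    using that A antisym by (auto simp: chains_below_def)
  show ?thesis
  proof (rule bij_betw_byWitness[where f' = "\<lambda>c. c - {A}"])
    show "\<forall>c\<in>\<Union>B\<in>{B \<in> P. le B A \<and> B \<noteq> A}. chains_below k B. insert A c - {A} = c"
      using notin by auto
    show "\<forall>c\<in>chains_below (Suc k) A. insert A (c - {A}) = c"
      using A by (auto simp: chains_below_def)
    show "insert A ` (\<Union>B\<in>{B \<in> P. le B A \<and> B \<noteq> A}. chains_below k B) \<subseteq> chains_below (Suc k) A"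
    proof clarify
      fix c B assume B: "B \<in> P" "le B A" "B \<noteq> A" and c: "c \<in> chains_below k B"
      have "chain c" using c by (simp add: chains_below_def)
      have "le C A" if "C \<in> c" for C
        using that c B A trans[of C B A] by (auto simp: chains_below_def chain_def)
      moreover have "card (insert A c) = Suc k"
        using notin[OF B c] c chain_finite[OF \<open>chain c\<close>] by (auto simp: chains_below_def)
      ultimately show "insert A c \<in> chains_below (Suc k) A"
        using \<open>chain c\<close> A refl by (auto simp: chains_below_def chain_def)
    qed
    show "(\<lambda>c. c - {A}) ` chains_below (Suc k) A \<subseteq> (\<Union>B\<in>{B \<in> P. le B A \<and> B \<noteq> A}. chains_below k B)"
    proof clarify
      fix c assume c: "c \<in> chains_below (Suc k) A"
      then have ch: "chain c" "chain (c - {A})" "A \<in> c" "card (c - {A}) = k"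
        using A by (auto simp: chains_below_def chain_def)
      then obtain B where B: "B \<in> P" "\<forall>C\<in>c - {A}. le C B" "B = bot \<and> c - {A} = {} \<or> B \<in> c - {A}"
        using chain_top by blast
      then have "c - {A} \<in> chains_below k B" using ch by (auto simp: chains_below_def)
      moreover have "le B A" "B \<noteq> A" using B A bot c by (auto simp: chains_below_def)
      ultimately show "c - {A} \<in> (\<Union>B\<in>{B \<in> P. le B A \<and> B \<noteq> A}. chains_below k B)"
        using B by blast
    qed
  qed
qed

lemma card_chains_below:
  "A \<in> P \<Longrightarrow> card (chains_below k A) = chain_count (rk A) k"
proof (induction k arbitrary: A)
  case 0
  have "chain {}" by (simp add: chain_def)
  moreover have "c \<in> chains_below 0 A \<Longrightarrow> c = {}" for c
    using chain_finite by (auto simp: chains_below_def)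
  ultimately have "chains_below 0 A = (if A = bot then {{}} else {})"
    by (auto simp: chains_below_def)
  then show ?case using 0 by (simp add: chain_count.simps rk_eq_0_iff)
next
  case (Suc k)
  show ?case
  proof (cases "A = bot")
    case True
    have "chains_below (Suc k) bot = {}"
    proof (rule equals0I)
      fix c assume c: "c \<in> chains_below (Suc k) bot"
      then have "B = bot" if "B \<in> c" for B
        using that antisym[of B bot] bot by (auto simp: chains_below_def chain_def)
      then have "c = {}" using c by (auto simp: chains_below_def chain_def)
      then show False using c by (simp add: chains_below_def)
    qed
    then show ?thesis using True by (simp add: rk_bot chain_count.simps)
  next
    case False
    let ?I = "{B \<in> P. le B A \<and> B \<noteq> A}"
    have fI: "finite ?I" using fin by simp
    have "card (chains_below (Suc k) A) = card (\<Union>B\<in>?I. chains_below k B)"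
      using bij_betw_same_card[OF chains_below_Suc[OF Suc.prems False]] by simp
    also have "\<dots> = (\<Sum>B\<in>?I. card (chains_below k B))"
      using fI finite_chains_below chains_below_disjoint by (intro card_UN_disjoint) blast+
    also have "\<dots> = (\<Sum>B\<in>?I. chain_count (rk B) k)"
      by (rule sum.cong) (auto simp: Suc.IH)
    \<comment> \<open>The possible tops after removal of A are sorted by rank, all of them less than
      the rank of A.\<close>
    also have "\<dots> = (\<Sum>i<rk A. \<Sum>B\<in>{B \<in> ?I. rk B = i}. chain_count (rk B) k)"
      using fI rk_less[OF Suc.prems] by (intro sum.group[symmetric]) auto
    also have "\<dots> = (\<Sum>i<rk A. (rk A choose i) * chain_count i k)"
    proof (rule sum.cong)
      fix i assume "i \<in> {..<rk A}"
      \<comment> \<open>The bound i < rk A already excludes B = A.\<close>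
      then have "{B \<in> ?I. rk B = i} = {B \<in> P. le B A \<and> rk B = i}" by auto
      then show "(\<Sum>B\<in>{B \<in> ?I. rk B = i}. chain_count (rk B) k) = (rk A choose i) * chain_count i k"
        using card_interval_rank[OF Suc.prems, of i] by simp
    qed simp
    finally show ?thesis by (simp add: chain_count.simps)
  qed
qed

lemma card_chains:
  "card {c. chain c \<and> card c = k} = (\<Sum>A\<in>P. chain_count (rk A) k)"
proof -
  have "{c. chain c \<and> card c = k} = (\<Union>A\<in>P. chains_below k A)"
    using chain_top by (auto simp: chains_below_def)
  moreover have "card \<dots> = (\<Sum>A\<in>P. card (chains_below k A))"
    using fin finite_chains_below chains_below_disjoint by (intro card_UN_disjoint) blast+
  ultimately show ?thesis by (simp add: card_chains_below)
qed

lemma card_chain_le: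
  assumes "chain c" "\<And>A. A \<in> P \<Longrightarrow> rk A \<le> d" shows "card c \<le> d"
proof (rule ccontr)
  assume "\<not> card c \<le> d"
  then have "(\<Sum>A\<in>P. chain_count (rk A) (card c)) = 0"
    using assms(2) by (auto intro!: sum.neutral chain_count_eq_0 simp: not_le intro: le_less_trans)
  then have "card {c'. chain c' \<and> card c' = card c} = 0" by (simp add: card_chains)
  \<comment> \<open>An infinite set would have cardinality 0 as well, so finiteness is needed to
    conclude emptiness.\<close>
  moreover have "finite {c'. chain c' \<and> card c' = card c}"
    by (rule finite_subset[of _ "Pow P"]) (use fin in \<open>auto simp: chain_def\<close>)
  ultimately show False using assms(1) by auto
qed

lemma chain_of_card_rk:
  assumes "A \<in> P" shows "\<exists>c. chain c \<and> card c = rk A"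
proof -
  have "card (chains_below (rk A) A) > 0"
    using assms by (simp add: card_chains_below chain_count_self_pos)
  then have "chains_below (rk A) A \<noteq> {}" by force
  then show ?thesis by (auto simp: chains_below_def)
qed

end

section \<open>Disks and invariance of domain\<close>

text \<open>\<open>Euclidean_space n\<close> consists of the real sequences that vanish from index n
  on, with the product topology; every continuity proof below is reduced to real coordinates in this
  way.\<close>

lemma continuous_map_into_Euclidean_space:
  "continuous_map X (Euclidean_space n) f \<longleftrightarrow>
     (\<forall>i. continuous_map X euclideanreal (\<lambda>x. f x i)) \<and> (\<forall>x\<in>topspace X. \<forall>i\<ge>n. f x i = 0)"
  by (auto simp: Euclidean_space_def continuous_map_in_subtopology continuous_map_componentwise_UNIV)

lemma continuous_map_Euclidean_coordinate:
  "continuous_map (Euclidean_space n) euclideanreal (\<lambda>x. x i)"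
  using continuous_map_into_Euclidean_space[of "Euclidean_space n" n "\<lambda>x. x"] by simp

lemma continuous_map_Euclidean_sum_squares:
  "continuous_map (Euclidean_space n) euclideanreal (\<lambda>x. \<Sum>i<n. (x i)\<^sup>2)"
  by (intro continuous_map_sum continuous_map_real_pow continuous_map_Euclidean_coordinate) auto

section \<open>Topology of the model disks\<close>

lemma disk_subset: "disk n \<subseteq> topspace (Euclidean_space n)"
  and open_disk_subset_disk: "open_disk n \<subseteq> disk n"
  and disk_boundary_eq: "disk_boundary n = disk n - open_disk n"
  by (auto simp: disk_def open_disk_def disk_boundary_def)

lemma openin_open_disk: "openin (Euclidean_space n) (open_disk n)"
  using openin_continuous_map_preimage[OF continuous_map_Euclidean_sum_squares, of "{..<1}" n]
  by (simp add: open_disk_def)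

lemma closedin_disk: "closedin (Euclidean_space n) (disk n)"
  using closedin_continuous_map_preimage[OF continuous_map_Euclidean_sum_squares, of "{..1}" n]
  by (simp add: disk_def)

lemma closedin_disk_boundary: "closedin (Euclidean_space n) (disk_boundary n)"
  using closedin_continuous_map_preimage[OF continuous_map_Euclidean_sum_squares, of "{1}" n]
  by (simp add: disk_boundary_def)

text \<open>The disk is closed in the space of all real sequences and lies in the cube of sequences
  with values in [-1, 1], compact by Tychonoff.\<close>

lemma compactin_disk: "compactin (Euclidean_space n) (disk n)"
proof -
  let ?K = "PiE UNIV (\<lambda>i::nat. {-1..1::real})"
  have "x i \<in> {-1..1}" if "x \<in> disk n" for x i
  proof (cases "i < n")
    case True
    then have "(x i)\<^sup>2 \<le> (\<Sum>i<n. (x i)\<^sup>2)" by (intro member_le_sum) auto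
    then have "(x i)\<^sup>2 \<le> 1" using that by (auto simp: disk_def)
    then show ?thesis by (auto simp: abs_square_le_1 abs_le_iff)
  next
    case False
    then show ?thesis using that by (auto simp: disk_def topspace_Euclidean_space)
  qed
  then have "disk n \<subseteq> ?K" by auto
  moreover have "compactin (powertop_real UNIV) ?K" by (simp add: compactin_PiE)
  moreover have "closedin (powertop_real UNIV) (disk n)"
    using closedin_disk[of n] closedin_Euclidean_space[of n]
    by (simp add: Euclidean_space_def closedin_closed_subtopology topspace_Euclidean_space)
  ultimately have "compactin (powertop_real UNIV) (disk n)"
    by (metis closed_compactin)
  then show ?thesis
    using disk_subset[of n]
    by (simp add: Euclidean_space_def compactin_subtopology topspace_Euclidean_space)
qed

lemma compactin_disk_boundary: "compactin (Euclidean_space n) (disk_boundary n)"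
  using closed_compactin[OF compactin_disk _ closedin_disk_boundary] disk_boundary_eq by blast

lemma continuous_map_ray:
  assumes "x \<in> topspace (Euclidean_space n)"
  shows "continuous_map euclideanreal (Euclidean_space n) (\<lambda>t i. t * x i)"
  using assms unfolding continuous_map_into_Euclidean_space topspace_Euclidean_space
  by (auto intro!: continuous_intros)

lemma scale_mem_open_disk:
  assumes "x \<in> disk n" "0 \<le> t" "t < 1"
  shows "(\<lambda>i. t * x i) \<in> open_disk n"
proof -
  have "(\<Sum>i<n. (t * x i)\<^sup>2) = t\<^sup>2 * (\<Sum>i<n. (x i)\<^sup>2)"
    by (simp add: power_mult_distrib sum_distrib_left)
  also have "\<dots> \<le> t\<^sup>2" using assms(1) by (simp add: disk_def mult_left_le)
  also have "\<dots> < 1" using assms by (simp add: abs_square_less_1)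
  finally show ?thesis
    using assms(1) by (simp add: open_disk_def disk_def topspace_Euclidean_space)
qed

text \<open>Each point is approached along its ray from the centre, whose points with t < 1 lie in
  the open disk.\<close>

lemma disk_subset_closure_open_disk: "disk n \<subseteq> Euclidean_space n closure_of open_disk n"
proof
  fix x assume x: "x \<in> disk n"
  let ?f = "\<lambda>t i. t * x i"
  have "continuous_map euclideanreal (Euclidean_space n) ?f"
    using x disk_subset by (intro continuous_map_ray) auto
  then have "?f ` (euclideanreal closure_of {0..<1}) \<subseteq> Euclidean_space n closure_of ?f ` {0..<1}"
    by (rule continuous_map_image_closure_subset)
  moreover have "?f ` {0..<1} \<subseteq> open_disk n" using scale_mem_open_disk[OF x] by auto
  moreover have "1 \<in> closure {0..<1::real}" by simp
  then have "?f 1 \<in> ?f ` (euclideanreal closure_of {0..<1})"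
    by (intro imageI) simp
  ultimately have "?f 1 \<in> Euclidean_space n closure_of open_disk n"
    using closure_of_mono by blast
  then show "x \<in> Euclidean_space n closure_of open_disk n" by simp
qed

text \<open>The open disk is a union of segments through the origin.\<close>

lemma connectedin_open_disk: "connectedin (Euclidean_space n) (open_disk n)"
proof -
  let ?R = "\<lambda>x. (\<lambda>t i. t * x i) ` {0..1::real}"
  have "connectedin (Euclidean_space n) (\<Union>(?R ` open_disk n))"
  proof (rule connectedin_Union)
    fix S assume "S \<in> ?R ` open_disk n"
    then obtain x where x: "x \<in> open_disk n" "S = ?R x" by blast
    have "continuous_map euclideanreal (Euclidean_space n) (\<lambda>t i. t * x i)"
      using x disk_subset open_disk_subset_disk by (intro continuous_map_ray) auto
    then show "connectedin (Euclidean_space n) S"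
      unfolding x(2) by (rule connectedin_continuous_map_image) simp
  next
    have "(\<lambda>i. 0) \<in> ?R x" for x :: "nat \<Rightarrow> real"
      by (rule image_eqI[of _ _ 0]) auto
    then show "\<Inter>(?R ` open_disk n) \<noteq> {}" by blast
  qed
  moreover have "\<Union>(?R ` open_disk n) = open_disk n"
  proof (intro equalityI subsetI)
    fix y assume "y \<in> \<Union>(?R ` open_disk n)"
    then obtain x t where x: "x \<in> open_disk n" "0 \<le> t" "t \<le> 1" "y = (\<lambda>i. t * x i)" by auto
    show "y \<in> open_disk n"
    proof (cases "t = 1")
      case False
      then show ?thesis
        using scale_mem_open_disk[of x n t] x open_disk_subset_disk[of n] by auto
    qed (use x in simp)
  next
    fix y assume y: "y \<in> open_disk n"
    have "y \<in> ?R y" by (rule image_eqI[of _ _ 1]) auto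
    with y show "y \<in> \<Union>(?R ` open_disk n)" by blast
  qed
  ultimately show ?thesis by simp
qed

lemma zero_in_open_disk: "(\<lambda>i. 0) \<in> open_disk n"
  by (simp add: open_disk_def topspace_Euclidean_space)

lemma disk_boundary_nonempty: "n > 0 \<Longrightarrow> disk_boundary n \<noteq> {}"
proof -
  assume "n > 0"
  then have "(\<Sum>i<n. (if i = 0 then 1 else 0 :: real)\<^sup>2) = 1"
    by (simp add: if_distrib[of "\<lambda>x. x\<^sup>2"] cong: if_cong)
  then have "(\<lambda>i. if i = 0 then 1 else 0) \<in> disk_boundary n"
    using \<open>n > 0\<close> by (simp add: disk_boundary_def topspace_Euclidean_space)
  then show ?thesis by blast
qed

text \<open>Used to refute openness of a non-empty set on which some coordinate below m is
  constant.\<close>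

lemma openin_Euclidean_perturb:
  assumes V: "openin (Euclidean_space m) V" "y \<in> V" and "k < m"
  shows "\<exists>t\<noteq>0. y(k := y k + t) \<in> V"
proof -
  have y: "y \<in> topspace (Euclidean_space m)" using V openin_subset by blast
  let ?f = "\<lambda>t::real. y(k := y k + t)"
  have "continuous_map euclideanreal (Euclidean_space m) ?f"
    unfolding continuous_map_into_Euclidean_space
  proof (intro conjI allI ballI impI)
    fix i show "continuous_map euclideanreal euclideanreal (\<lambda>t. ?f t i)"
      by (cases "i = k") (auto intro!: continuous_intros)
  qed (use y assms(3) in \<open>auto simp: topspace_Euclidean_space\<close>)
  from openin_continuous_map_preimage[OF this V(1)]
  have "open {t. ?f t \<in> V}" by simp
  moreover have "0 \<in> {t. ?f t \<in> V}" using V by simp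
  ultimately obtain e where e: "e > 0" "\<And>t. dist t 0 < e \<Longrightarrow> ?f t \<in> V"
    unfolding open_dist by blast
  have "?f (e / 2) \<in> V" using e by (intro e(2)) (simp add: dist_norm)
  then show ?thesis using e(1) by (intro exI[of _ "e / 2"]) auto
qed

lemma continuous_map_Euclidean_space_mono:
  "continuous_map X (Euclidean_space n) f \<Longrightarrow> n \<le> m \<Longrightarrow> continuous_map X (Euclidean_space m) f"
  by (auto simp: continuous_map_into_Euclidean_space)

text \<open>If n < m, then f also maps into m-space, where invariance of domain makes its image
  open; but coordinate n is 0 throughout that image.\<close>

lemma injective_Euclidean_dim_le:
  assumes U: "openin (Euclidean_space m) U" "U \<noteq> {}"
    and f: "continuous_map (subtopology (Euclidean_space m) U) (Euclidean_space n) f" "inj_on f U"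
  shows "m \<le> n"
proof (rule ccontr)
  assume "\<not> m \<le> n"
  then have "n < m" by simp
  then have "openin (Euclidean_space m) (f ` U)"
    using invariance_of_domain_Euclidean_space[OF U(1) continuous_map_Euclidean_space_mono[OF f(1)] f(2)]
    by simp
  moreover obtain y where "y \<in> f ` U" using U by blast
  ultimately obtain t where "t \<noteq> 0" "y(n := y n + t) \<in> f ` U"
    using openin_Euclidean_perturb[of m _ y n] \<open>n < m\<close> by blast
  moreover have "z n = 0" if "z \<in> f ` U" for z
    using that f(1) openin_subset[OF U(1)] unfolding continuous_map_into_Euclidean_space by auto
  ultimately show False using \<open>y \<in> f ` U\<close> by (metis add_0 fun_upd_same)
qed

text \<open>Coning the map off radially turns it into an injective map on an open subset of n-space.\<close>

lemma invariance_of_domain_disk_boundary: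
  assumes U: "openin (subtopology (Euclidean_space n) (disk_boundary n)) U" "U \<noteq> {}"
    and h: "continuous_map (subtopology (Euclidean_space n) U) (Euclidean_space m) h" "inj_on h U"
    and "m < n"
  shows "n = Suc m \<and> openin (Euclidean_space m) (h ` U)"
proof -
  define N :: "(nat \<Rightarrow> real) \<Rightarrow> real" where "N x = (\<Sum>i<n. (x i)\<^sup>2)" for x
  define \<rho> :: "(nat \<Rightarrow> real) \<Rightarrow> nat \<Rightarrow> real" where "\<rho> x = (\<lambda>i. x i / sqrt (N x))" for x
  \<comment> \<open>\<open>P\<close> removes the apex, where no direction exists; \<open>W\<close>
    is the open cone over \<open>U\<close> without its apex.\<close>
  define P where "P = {x \<in> topspace (Euclidean_space n). N x \<in> {0<..}}"
  define W where "W = {x \<in> topspace (subtopology (Euclidean_space n) P). \<rho> x \<in> U}"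
  \<comment> \<open>The values of h vanish from coordinate m \<le> n - 1 on, so coordinate n - 1 is
    free to record the squared norm. Direction and norm together recover x, which makes
    \<open>F\<close> injective.\<close>
  define F where "F x = (h (\<rho> x))(n - 1 := N x)" for x
  have UB: "U \<subseteq> disk_boundary n" using openin_imp_subset[OF U(1)] .
  have UE: "U \<subseteq> topspace (Euclidean_space n)" using UB by (auto simp: disk_boundary_def)
  have N1: "N u = 1" "\<rho> u = u" if "u \<in> U" for u
    using that UB by (auto simp: disk_boundary_def N_def \<rho>_def)
  have hz: "h u i = 0" if "u \<in> U" "i \<ge> m" for u i
    using that h(1) UE by (auto simp: continuous_map_into_Euclidean_space)
  have cN: "continuous_map (Euclidean_space n) euclideanreal N"
    unfolding N_def by (rule continuous_map_Euclidean_sum_squares)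
  have opP: "openin (Euclidean_space n) P"
    unfolding P_def by (rule openin_continuous_map_preimage[OF cN]) simp
  have c\<rho>: "continuous_map (subtopology (Euclidean_space n) P) (Euclidean_space n) \<rho>"
    unfolding continuous_map_into_Euclidean_space \<rho>_def
  proof (intro conjI allI ballI impI)
    fix i show "continuous_map (subtopology (Euclidean_space n) P) euclideanreal (\<lambda>x. x i / sqrt (N x))"
      by (intro continuous_map_real_divide continuous_map_compose[of _ euclideanreal N _ sqrt, unfolded o_def]
         continuous_map_from_subtopology continuous_map_Euclidean_coordinate cN)
        (auto simp: P_def continuous_on_real_sqrt)
  qed (auto simp: topspace_Euclidean_space)
  have N\<rho>: "\<rho> x \<in> disk_boundary n" if "x \<in> P" for x
  proof -
    have "(\<Sum>i<n. (\<rho> x i)\<^sup>2) = N x / N x"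
      using that by (simp add: \<rho>_def power_divide P_def sum_divide_distrib[symmetric] N_def)
    then show ?thesis using that by (auto simp: disk_boundary_def P_def topspace_Euclidean_space \<rho>_def)
  qed
  have "continuous_map (subtopology (Euclidean_space n) P) (subtopology (Euclidean_space n) (disk_boundary n)) \<rho>"
    using c\<rho> N\<rho> by (auto simp: continuous_map_in_subtopology)
  from openin_continuous_map_preimage[OF this U(1)]
  have opW: "openin (Euclidean_space n) W"
    unfolding W_def using openin_trans_full[OF _ opP] by blast
  have WP: "W \<subseteq> P" by (auto simp: W_def)
  have "continuous_map (subtopology (Euclidean_space n) W) (subtopology (Euclidean_space n) U) \<rho>"
    using continuous_map_from_subtopology_mono[OF c\<rho> WP]
    by (auto simp: continuous_map_in_subtopology W_def)
  then have ch\<rho>: "continuous_map (subtopology (Euclidean_space n) W) (Euclidean_space m) (\<lambda>x. h (\<rho> x))"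
    using continuous_map_compose[OF _ h(1)] by (simp add: o_def)
  have cF: "continuous_map (subtopology (Euclidean_space n) W) (Euclidean_space n) F"
    unfolding continuous_map_into_Euclidean_space
  proof (intro conjI allI ballI impI)
    fix i show "continuous_map (subtopology (Euclidean_space n) W) euclideanreal (\<lambda>x. F x i)"
      using ch\<rho> cN unfolding continuous_map_into_Euclidean_space F_def
      by (cases "i = n - 1") (auto intro: continuous_map_from_subtopology)
  next
    fix x i assume "x \<in> topspace (subtopology (Euclidean_space n) W)" "n \<le> i"
    then show "F x i = 0" using hz[of "\<rho> x" i] \<open>m < n\<close> by (auto simp: F_def W_def)
  qed
  have "inj_on F W"
  proof (rule inj_onI)
    fix x y assume xy: "x \<in> W" "y \<in> W" "F x = F y"
    have N: "N x = N y" using fun_cong[OF xy(3), of "n - 1"] by (simp add: F_def)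
    have "h (\<rho> x) i = h (\<rho> y) i" for i
    proof (cases "i = n - 1")
      case True
      then show ?thesis using hz[of "\<rho> x" i] hz[of "\<rho> y" i] xy \<open>m < n\<close> by (auto simp: W_def)
    next
      case False
      then show ?thesis using fun_cong[OF xy(3), of i] by (simp add: F_def)
    qed
    then have "h (\<rho> x) = h (\<rho> y)" by blast
    then have "\<rho> x = \<rho> y" using h(2) xy by (auto simp: W_def inj_on_def)
    moreover have "N x > 0" using xy WP by (auto simp: P_def)
    ultimately show "x = y" using N unfolding \<rho>_def fun_eq_iff by auto
  qed
  then have opF: "openin (Euclidean_space n) (F ` W)"
    by (rule invariance_of_domain_Euclidean_space[OF opW cF])
  have UW: "U \<subseteq> W" using N1 UE by (auto simp: W_def P_def)
  have "n = Suc m"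
  proof (rule ccontr)
    assume "n \<noteq> Suc m"
    \<comment> \<open>Then coordinate m lies strictly between those used by h and the norm
      coordinate, and is 0 on the whole open image of \<open>W\<close>.\<close>
    then have "m < n - 1" using \<open>m < n\<close> by simp
    obtain u where "u \<in> U" using U by blast
    then have "F u \<in> F ` W" using UW by blast
    then obtain t where "t \<noteq> 0" "(F u)(m := F u m + t) \<in> F ` W"
      using openin_Euclidean_perturb[OF opF _ \<open>m < n\<close>] by blast
    moreover have "F x m = 0" if "x \<in> W" for x
      using that hz[of "\<rho> x" m] \<open>m < n - 1\<close> by (auto simp: F_def W_def)
    ultimately show False using \<open>u \<in> U\<close> UW by (metis fun_upd_same add_0 imageE subsetD)
  qed
  moreover have "openin (Euclidean_space m) (h ` U)"
  proof -
    \<comment> \<open>With n = Suc m the norm sits in coordinate m. The image of \<open>U\<close>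
      under h is the slice of the open image of \<open>W\<close> at squared norm 1, and slicing is a
      continuous preimage.\<close>
    have "continuous_map (Euclidean_space m) (Euclidean_space n) (\<lambda>y. y(m := 1))"
      unfolding continuous_map_into_Euclidean_space
    proof (intro conjI allI ballI impI)
      fix i show "continuous_map (Euclidean_space m) euclideanreal (\<lambda>y. (y(m := 1)) i)"
        by (cases "i = m") (auto intro: continuous_map_Euclidean_coordinate)
    qed (use \<open>m < n\<close> in \<open>auto simp: topspace_Euclidean_space\<close>)
    then have "openin (Euclidean_space m) {y \<in> topspace (Euclidean_space m). y(m := 1) \<in> F ` W}"
      using opF by (rule openin_continuous_map_preimage)
    also have "{y \<in> topspace (Euclidean_space m). y(m := 1) \<in> F ` W} = h ` U"
    proof (intro equalityI subsetI)
      fix y assume "y \<in> h ` U"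
      then obtain u where u: "u \<in> U" "y = h u" by blast
      have "F u = y(m := 1)" using u N1[of u] \<open>n = Suc m\<close> by (simp add: F_def)
      then show "y \<in> {y \<in> topspace (Euclidean_space m). y(m := 1) \<in> F ` W}"
        using u UW hz[OF u(1)] by (force simp: topspace_Euclidean_space)
    next
      fix y assume "y \<in> {y \<in> topspace (Euclidean_space m). y(m := 1) \<in> F ` W}"
      then obtain x where x: "y \<in> topspace (Euclidean_space m)" "x \<in> W" "y(m := 1) = F x" by blast
      have "y i = h (\<rho> x) i" for i
      proof (cases "i = m")
        case True
        then show ?thesis using x hz[of "\<rho> x" m] by (auto simp: W_def topspace_Euclidean_space)
      next
        case False
        then show ?thesis using fun_cong[OF x(3), of i] \<open>n = Suc m\<close> by (simp add: F_def)
      qed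
      then have "y = h (\<rho> x)" by blast
      then show "y \<in> h ` U" using x(2) by (simp add: W_def)
    qed
    finally show ?thesis .
  qed
  ultimately show ?thesis by blast
qed

section \<open>Cells of a regular CW-complex\<close>

text \<open>Applied in both directions, this makes the description in \<open>cell_dim\<close>
  unique.\<close>

lemma open_disk_homeomorphic_imp_le:
  assumes "subtopology (Euclidean_space m) (open_disk m) homeomorphic_space
           subtopology (Euclidean_space n) (open_disk n)"
  shows "m \<le> n"
proof -
  obtain f where "homeomorphic_map (subtopology (Euclidean_space m) (open_disk m))
      (subtopology (Euclidean_space n) (open_disk n)) f"
    using assms homeomorphic_space by blast
  then have "continuous_map (subtopology (Euclidean_space m) (open_disk m)) (Euclidean_space n) f"
    "inj_on f (open_disk m)"
    using openin_subset[OF openin_open_disk[of m]]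
    by (auto simp: homeomorphic_eq_everything_map continuous_map_in_subtopology inf_absorb2)
  then show ?thesis
    using injective_Euclidean_dim_le[OF openin_open_disk] zero_in_open_disk by blast
qed

lemma cell_dim_eq:
  assumes "characteristic_map X C n e \<phi>" shows "cell_dim X e = n"
  unfolding cell_dim_def
proof (rule the_equality)
  show 1: "subtopology X e homeomorphic_space subtopology (Euclidean_space n) (open_disk n)"
    using assms homeomorphic_map_imp_homeomorphic_space homeomorphic_space_sym
    unfolding characteristic_map_def by blast
  fix m assume 2: "subtopology X e homeomorphic_space subtopology (Euclidean_space m) (open_disk m)"
  show "m = n"
    using open_disk_homeomorphic_imp_le homeomorphic_space_trans homeomorphic_space_sym 1 2
    by (metis order_antisym)
qed

context
  fixes X :: "'a topology" and C :: "'a set set"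
  assumes reg: "regular_cw_complex X C"
begin

lemma cell_subset: "e \<in> C \<Longrightarrow> e \<subseteq> topspace X"
  using reg by (auto simp: regular_cw_complex_def cw_complex_def)

lemma cell_subset_closure: "e \<in> C \<Longrightarrow> e \<subseteq> X closure_of e"
  by (simp add: cell_subset closure_of_subset)

lemma cells_disjoint: "e \<in> C \<Longrightarrow> e' \<in> C \<Longrightarrow> x \<in> e \<Longrightarrow> x \<in> e' \<Longrightarrow> e = e'"
  using reg unfolding regular_cw_complex_def cw_complex_def disjoint_def by blast

text \<open>The image of the compact disk is closed in the Hausdorff space X, hence contains the
  closure of e; density of the open disk gives the converse. Injectivity keeps the image of the
  sphere apart from e.\<close>

lemma regular_cell:
  assumes e: "e \<in> C"
  obtains \<phi> where
    "continuous_map (subtopology (Euclidean_space (cell_dim X e)) (disk (cell_dim X e))) X \<phi>"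
    "inj_on \<phi> (disk (cell_dim X e))"
    "homeomorphic_map (subtopology (Euclidean_space (cell_dim X e)) (open_disk (cell_dim X e)))
       (subtopology X e) \<phi>"
    "\<phi> ` open_disk (cell_dim X e) = e"
    "\<phi> ` disk (cell_dim X e) = X closure_of e"
    "\<phi> ` disk_boundary (cell_dim X e) = X closure_of e - e"
    "\<exists>F. finite F \<and> F \<subseteq> C \<and> (\<forall>e'\<in>F. cell_dim X e' < cell_dim X e) \<and> X closure_of e - e \<subseteq> \<Union>F"
proof -
  obtain n \<phi> where ch: "characteristic_map X C n e \<phi>"
    and emb: "embedding_map (subtopology (Euclidean_space n) (disk n)) X \<phi>"
    using reg e unfolding regular_cw_complex_def by blast
  have n: "cell_dim X e = n" using cell_dim_eq[OF ch] .
  have tD: "topspace (subtopology (Euclidean_space n) (disk n)) = disk n"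
    using disk_subset[of n] by auto
  have cont: "continuous_map (subtopology (Euclidean_space n) (disk n)) X \<phi>"
    and hom: "homeomorphic_map (subtopology (Euclidean_space n) (open_disk n)) (subtopology X e) \<phi>"
    and fin: "\<exists>F. finite F \<and> F \<subseteq> C \<and> (\<forall>e'\<in>F. cell_dim X e' < n) \<and> \<phi> ` disk_boundary n \<subseteq> \<Union>F"
    using ch by (auto simp: characteristic_map_def)
  have inj: "inj_on \<phi> (disk n)"
    using emb tD by (simp add: embedding_map_def homeomorphic_eq_everything_map)
  have tO: "topspace (subtopology (Euclidean_space n) (open_disk n)) = open_disk n"
    using openin_subset[OF openin_open_disk[of n]] by auto
  have im: "\<phi> ` open_disk n = e"
    using homeomorphic_imp_surjective_map[OF hom] cell_subset[OF e] tO by auto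
  have cl: "\<phi> ` disk n = X closure_of e"
  proof
    have "compactin (subtopology (Euclidean_space n) (disk n)) (disk n)"
      by (simp add: compactin_subtopology compactin_disk)
    then have "compactin X (\<phi> ` disk n)" using cont by (rule image_compactin)
    then have "closedin X (\<phi> ` disk n)"
      using reg by (simp add: compactin_imp_closedin regular_cw_complex_def cw_complex_def)
    moreover have "e \<subseteq> \<phi> ` disk n" using im open_disk_subset_disk by blast
    ultimately show "X closure_of e \<subseteq> \<phi> ` disk n" by (simp add: closure_of_minimal)
    have "disk n \<subseteq> subtopology (Euclidean_space n) (disk n) closure_of open_disk n"
      using disk_subset_closure_open_disk[of n] open_disk_subset_disk[of n]
      by (simp add: closure_of_subtopology inf_absorb2)
    then show "\<phi> ` disk n \<subseteq> X closure_of e"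
      using continuous_map_image_closure_subset[OF cont, of "open_disk n"] im by blast
  qed
  have bd: "\<phi> ` disk_boundary n = X closure_of e - e"
    using inj_on_image_set_diff[OF inj _ open_disk_subset_disk[of n], of "disk n"] cl im
    by (simp add: disk_boundary_eq)
  show thesis
    using that[of \<phi>] cont inj hom im cl bd fin unfolding n by auto
qed

lemma cell_nonempty: assumes "e \<in> C" shows "e \<noteq> {}"
proof -
  obtain \<phi> where "\<phi> ` open_disk (cell_dim X e) = e"
    using regular_cell[OF assms] by metis
  then show ?thesis using zero_in_open_disk by blast
qed

text \<open>Closure-finiteness supplies some cell of smaller dimension through x; by disjointness it
  is e'.\<close>

lemma cell_dim_less:
  assumes "e \<in> C" "e' \<in> C" "x \<in> e'" "x \<in> X closure_of e - e"
  shows "cell_dim X e' < cell_dim X e"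
proof -
  obtain F where F: "F \<subseteq> C" "\<forall>e'\<in>F. cell_dim X e' < cell_dim X e" "X closure_of e - e \<subseteq> \<Union>F"
    using regular_cell[OF assms(1)] by metis
  then obtain e'' where "e'' \<in> F" "x \<in> e''" using assms by blast
  then show ?thesis using F cells_disjoint[of e' e'' x] assms by blast
qed

text \<open>Any point of e' lies in the closure of e and, by disjointness, outside e.\<close>

lemma cell_dim_less_face:
  assumes "e \<in> C" "e' \<in> C" "face_le X e' e" "e' \<noteq> e"
  shows "cell_dim X e' < cell_dim X e"
proof -
  obtain x where "x \<in> e'" using cell_nonempty[OF assms(2)] by blast
  moreover have "x \<in> X closure_of e - e"
    using assms \<open>x \<in> e'\<close> cell_subset_closure[of e'] cells_disjoint[of e e' x]
    unfolding face_le_def by blast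
  ultimately show ?thesis using cell_dim_less assms by blast
qed

text \<open>A cell of maximal dimension meeting the boundary sphere of e meets it in an open subset of
  the sphere. By invariance of domain the intersection is also open in that cell, hence all of it.\<close>

lemma cell_facet:
  assumes e: "e \<in> C" and pos: "cell_dim X e > 0"
  obtains e' where "e' \<in> C" "cell_dim X e = Suc (cell_dim X e')" "face_le X e' e"
proof -
  define n where "n = cell_dim X e"
  define S where "S = X closure_of e - e"
  obtain \<phi> F where cont: "continuous_map (subtopology (Euclidean_space n) (disk n)) X \<phi>"
    and inj: "inj_on \<phi> (disk n)" and bd: "\<phi> ` disk_boundary n = S"
    and F: "finite F" "F \<subseteq> C" "S \<subseteq> \<Union>F"
    unfolding n_def S_def by (rule regular_cell[OF e]) metis
  have bsub: "disk_boundary n \<subseteq> disk n" by (simp add: disk_boundary_eq)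
  have haus: "Hausdorff_space X" using reg by (simp add: regular_cw_complex_def cw_complex_def)
  \<comment> \<open>Cells of \<open>F\<close> that miss \<open>S\<close> are discarded, so that the
    maximal dimension is attained by a cell that really meets \<open>S\<close>.\<close>
  define M where "M = {e' \<in> F. e' \<inter> S \<noteq> {}}"
  have M: "finite M" "M \<subseteq> C" using F by (auto simp: M_def)
  have SM: "S \<subseteq> \<Union>M" unfolding M_def using F(3) by blast
  have "S \<noteq> {}" using disk_boundary_nonempty[of n] pos bd by (auto simp: n_def)
  then have "M \<noteq> {}" using SM by blast
  then have "Max (cell_dim X ` M) \<in> cell_dim X ` M" using M by simp
  then obtain e' where e': "e' \<in> M" "cell_dim X e' = Max (cell_dim X ` M)" by auto
  have e'C: "e' \<in> C" using e' M by blast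
  define m where "m = cell_dim X e'"
  have max: "cell_dim X e'' \<le> m" if "e'' \<in> M" for e''
    using that e' M by (simp add: m_def)
  have "m < n"
    using e'(1) cell_dim_less[OF e e'C] by (auto simp: M_def S_def m_def n_def)
  \<comment> \<open>This closed set covers the part of \<open>S\<close> outside e'. It misses e',
    since a point of e' in the closure of another cell of \<open>M\<close> would give that cell a
    dimension above the maximum m.\<close>
  define T where "T = (\<Union>e''\<in>M - {e'}. X closure_of e'')"
  have "closedin X T" unfolding T_def using M by (intro closedin_Union) auto
  have "e' \<inter> T = {}"
  proof (rule equals0I)
    fix x assume x: "x \<in> e' \<inter> T"
    then obtain e'' where e'': "e'' \<in> M" "e'' \<noteq> e'" "x \<in> X closure_of e''" by (auto simp: T_def)
    have "x \<notin> e''" using cells_disjoint[of e' e'' x] x e'' e'C M by blast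
    then have "m < cell_dim X e''"
      using cell_dim_less[of e'' e' x] x e'' e'C M unfolding m_def by blast
    then show False using max[OF e''(1)] by simp
  qed
  moreover have "S \<subseteq> e' \<union> T"
  proof
    fix x assume "x \<in> S"
    then obtain e'' where "e'' \<in> M" "x \<in> e''" using SM by blast
    moreover from this have "x \<in> X closure_of e''" using cell_subset_closure M by blast
    ultimately show "x \<in> e' \<union> T" by (auto simp: T_def)
  qed
  moreover have "S \<subseteq> topspace X"
    unfolding S_def using closure_of_subset_topspace[of X e] by blast
  ultimately have eqS: "e' \<inter> S = S \<inter> (topspace X - T)" by blast
  have contb: "continuous_map (subtopology (Euclidean_space n) (disk_boundary n)) X \<phi>"
    using continuous_map_from_subtopology_mono[OF cont bsub] .
  have tB: "topspace (subtopology (Euclidean_space n) (disk_boundary n)) = disk_boundary n"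
    using bsub disk_subset[of n] by auto
  define U where "U = {x \<in> disk_boundary n. \<phi> x \<in> e'}"
  have \<phi>U: "\<phi> ` U = e' \<inter> S" using bd by (auto simp: U_def)
  have "U = {x \<in> topspace (subtopology (Euclidean_space n) (disk_boundary n)). \<phi> x \<in> topspace X - T}"
    unfolding tB U_def using eqS bd by blast
  then have opU: "openin (subtopology (Euclidean_space n) (disk_boundary n)) U"
    using openin_continuous_map_preimage[OF contb, of "topspace X - T"] \<open>closedin X T\<close> by auto
  have "U \<noteq> {}" using \<phi>U e'(1) by (auto simp: M_def)
  obtain \<psi> where hom: "homeomorphic_map (subtopology (Euclidean_space m) (open_disk m)) (subtopology X e') \<psi>"
    and im: "\<psi> ` open_disk m = e'"
    unfolding m_def by (rule regular_cell[OF e'C]) metis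
  obtain \<psi>' where maps: "homeomorphic_maps (subtopology (Euclidean_space m) (open_disk m)) (subtopology X e') \<psi> \<psi>'"
    using hom homeomorphic_map_maps by blast
  have te': "topspace (subtopology X e') = e'" using cell_subset[OF e'C] by auto
  have \<psi>': "continuous_map (subtopology X e') (Euclidean_space m) \<psi>'" "\<And>y. y \<in> e' \<Longrightarrow> \<psi> (\<psi>' y) = y"
    using maps te' by (auto simp: homeomorphic_maps_def continuous_map_in_subtopology)
  have "continuous_map (subtopology (Euclidean_space n) U) (subtopology X e') \<phi>"
    using continuous_map_from_subtopology_mono[OF contb, of U]
    by (auto simp: continuous_map_in_subtopology U_def)
  from continuous_map_compose[OF this \<psi>'(1)]
  have ch: "continuous_map (subtopology (Euclidean_space n) U) (Euclidean_space m) (\<psi>' \<circ> \<phi>)" .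
  have "inj_on (\<psi>' \<circ> \<phi>) U"
  proof (rule inj_onI)
    fix x y assume xy: "x \<in> U" "y \<in> U" "(\<psi>' \<circ> \<phi>) x = (\<psi>' \<circ> \<phi>) y"
    then have "\<phi> x = \<phi> y" using \<psi>'(2) by (metis (mono_tags, lifting) U_def comp_apply mem_Collect_eq)
    then show "x = y" using xy inj bsub by (auto simp: U_def inj_on_def)
  qed
  then have nm: "n = Suc m" and opH: "openin (Euclidean_space m) ((\<psi>' \<circ> \<phi>) ` U)"
    using invariance_of_domain_disk_boundary[OF opU \<open>U \<noteq> {}\<close> ch _ \<open>m < n\<close>] by auto
  \<comment> \<open>The open set is carried back from coordinates to the cell: the part of e' in
    \<open>S\<close> is open in e'.\<close>
  have "(\<psi>' \<circ> \<phi>) ` U \<subseteq> open_disk m"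
    using maps te' by (auto simp: homeomorphic_maps_def continuous_map_def U_def)
  then have "openin (subtopology (Euclidean_space m) (open_disk m)) ((\<psi>' \<circ> \<phi>) ` U)"
    using opH by (simp add: openin_open_subtopology openin_open_disk)
  then have "openin (subtopology X e') (\<psi> ` (\<psi>' \<circ> \<phi>) ` U)"
    using hom by (auto simp: homeomorphic_eq_everything_map open_map_def)
  moreover have "\<psi> ` (\<psi>' \<circ> \<phi>) ` U = e' \<inter> S"
    using \<psi>'(2) unfolding \<phi>U[symmetric] by (force simp: image_image U_def)
  ultimately have op: "openin (subtopology X e') (e' \<inter> S)" by simp
  \<comment> \<open>It is closed as well, because \<open>S\<close> is the image of a compact sphere.
    The cell e' is connected, so it lies in \<open>S\<close> entirely.\<close>
  have "compactin (subtopology (Euclidean_space n) (disk_boundary n)) (disk_boundary n)"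
    by (simp add: compactin_subtopology compactin_disk_boundary)
  then have "compactin X S" using image_compactin[OF _ contb] bd by blast
  then have "closedin X S" using haus by (rule compactin_imp_closedin[rotated])
  then have "closedin (subtopology X e') (e' \<inter> S)"
    by (auto simp: closedin_subtopology)
  moreover have "connected_space (subtopology (Euclidean_space m) (open_disk m))"
    using connectedin_open_disk by (simp add: connectedin_def)
  then have "connected_space (subtopology X e')"
    using hom homeomorphic_connected_space homeomorphic_map_imp_homeomorphic_space by blast
  ultimately have "e' \<inter> S = {} \<or> e' \<inter> S = e'"
    using op te' unfolding connected_space_clopen_in by auto
  then have "e' \<subseteq> S" using e'(1) by (auto simp: M_def)
  then have "X closure_of e' \<subseteq> X closure_of e"
    by (intro closure_of_minimal) (auto simp: S_def)
  then show thesis using that[of e'] e'C nm by (simp add: face_le_def m_def n_def)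
qed

end

section \<open>Faces of a Boolean cell complex\<close>

text \<open>The shift by one gives the empty face rank 0, as the bottom of a Boolean lattice must
  have.\<close>

definition face_rank :: "'a topology \<Rightarrow> 'a set \<Rightarrow> nat" where
  "face_rank X A = nat (face_dim X A + 1)"

lemma face_rank_empty [simp]: "face_rank X {} = 0"
  and face_rank_nonempty: "A \<noteq> {} \<Longrightarrow> face_rank X A = Suc (cell_dim X A)"
  and face_dim_eq_face_rank: "face_dim X A = int (face_rank X A) - 1"
  by (auto simp: face_rank_def face_dim_def)

lemma face_le_empty: "face_le X {} A"
  by (simp add: face_le_def)

lemma face_le_refl: "face_le X A A"
  and face_le_trans: "face_le X A B \<Longrightarrow> face_le X B D \<Longrightarrow> face_le X A D"
  by (auto simp: face_le_def)

context
  fixes X :: "'a topology" and C :: "'a set set"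
  assumes bc: "boolean_cell_complex X C"
begin

lemma regular: "regular_cw_complex X C" and finite_faces: "finite (faces C)"
  using bc by (auto simp: boolean_cell_complex_def faces_def)

lemma face_interval:
  assumes "A \<in> faces C"
  shows "\<exists>(n::nat) g. bij_betw g {B \<in> faces C. face_le X B A} (Pow {..<n}) \<and>
    (\<forall>x\<in>{B \<in> faces C. face_le X B A}. \<forall>y\<in>{B \<in> faces C. face_le X B A}.
      face_le X x y \<longleftrightarrow> g x \<subseteq> g y)"
  using bc assms by (auto simp: boolean_cell_complex_def face_le_empty boolean_lattice_def)

text \<open>Comparing closures gives only a preorder on sets; for faces, antisymmetry is inherited
  from set inclusion through the injective g.\<close>

lemma face_le_antisym:
  assumes "A \<in> faces C" "B \<in> faces C" "face_le X A B" "face_le X B A" shows "A = B"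
proof -
  obtain n g where g: "bij_betw g {B \<in> faces C. face_le X B A} (Pow {..<n::nat})"
    and mono: "\<And>x y. x \<in> {B \<in> faces C. face_le X B A} \<Longrightarrow> y \<in> {B \<in> faces C. face_le X B A} \<Longrightarrow>
      face_le X x y \<longleftrightarrow> g x \<subseteq> g y"
    using face_interval[OF assms(1)] by blast
  have AB: "A \<in> {B \<in> faces C. face_le X B A}" "B \<in> {B \<in> faces C. face_le X B A}"
    using assms face_le_refl by auto
  then have "g A = g B" using mono[OF AB] mono[OF AB(2,1)] assms by blast
  then show ?thesis using bij_betw_imp_inj_on[OF g] AB by (meson inj_onD)
qed

lemma face_rank_less:
  assumes "A \<in> faces C" "B \<in> faces C" "face_le X B A" "B \<noteq> A"
  shows "face_rank X B < face_rank X A"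
proof -
  have "A \<noteq> {}" using assms face_le_antisym face_le_empty by blast
  show ?thesis
  proof (cases "B = {}")
    case True
    then show ?thesis using \<open>A \<noteq> {}\<close> by (simp add: face_rank_nonempty)
  next
    case False
    then show ?thesis
      using \<open>A \<noteq> {}\<close> assms cell_dim_less_face[OF regular, of A B]
      by (simp add: face_rank_nonempty faces_def)
  qed
qed

text \<open>The size of the interval determines the exponent n of its Boolean isomorphism, so it
  suffices to squeeze n between two bounds, each using the induction hypothesis on one face of
  A.\<close>

lemma card_face_interval:
  assumes "A \<in> faces C"
  shows "card {B \<in> faces C. face_le X B A} = 2 ^ face_rank X A"
  using assms
proof (induction "face_rank X A" arbitrary: A rule: less_induct)
  case less
  let ?I = "\<lambda>A. {B \<in> faces C. face_le X B A}"
  obtain n g where g: "bij_betw g (?I A) (Pow {..<n::nat})"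
    and mono: "\<And>x y. x \<in> ?I A \<Longrightarrow> y \<in> ?I A \<Longrightarrow> face_le X x y \<longleftrightarrow> g x \<subseteq> g y"
    using face_interval[OF less.prems] by blast
  have IH: "card (?I B) = 2 ^ face_rank X B" if "B \<in> ?I A" "B \<noteq> A" for B
    using that less.hyps[of B] face_rank_less[OF less.prems, of B] by simp
  have card: "card (?I A) = 2 ^ n" using bij_betw_same_card[OF g] by (simp add: card_Pow)
  have AI: "A \<in> ?I A" using less.prems face_le_refl by blast
  have "n \<le> face_rank X A"
  proof (cases n)
    case (Suc k)
    have "{..<k} \<in> g ` ?I A" using g Suc by (auto simp: bij_betw_def)
    \<comment> \<open>A coatom of the Boolean lattice. By induction its Boolean rank k is its face
      rank, which is less than that of A.\<close>
    then obtain B where B: "B \<in> ?I A" "g B = {..<k}" by blast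
    have "{..<n} \<in> g ` ?I A" using g by (auto simp: bij_betw_def)
    then have "{..<n} \<subseteq> g A" using mono AI by blast
    then have "B \<noteq> A" using B Suc by auto
    have IB: "?I B \<subseteq> ?I A" using B face_le_trans by blast
    have "bij_betw g (?I B) (Pow {..<k})"
    proof (rule bij_betw_subset[OF g IB])
      show "g ` ?I B = Pow {..<k}"
      proof (intro equalityI subsetI)
        fix S assume "S \<in> Pow {..<k}"
        then have "S \<in> Pow {..<n}" "S \<subseteq> g B" using Suc B by auto
        then have "S \<in> g ` ?I A" using g by (auto simp: bij_betw_def)
        then obtain D where D: "D \<in> ?I A" "S = g D" by blast
        then have "face_le X D B" using mono[OF D(1) B(1)] \<open>S \<subseteq> g B\<close> by simp
        then show "S \<in> g ` ?I B" using D by blast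
      next
        fix S assume "S \<in> g ` ?I B"
        then obtain D where D: "D \<in> ?I B" "S = g D" by blast
        then have "S \<subseteq> g B" using mono[of D B] IB B(1) by blast
        then show "S \<in> Pow {..<k}" using B by simp
      qed
    qed
    then have "card (?I B) = 2 ^ k" using bij_betw_same_card by (fastforce simp: card_Pow)
    then have "k = face_rank X B" using IH[OF B(1) \<open>B \<noteq> A\<close>] by simp
    then show ?thesis using face_rank_less[OF less.prems, of B] B \<open>B \<noteq> A\<close> Suc by simp
  qed simp
  moreover have "face_rank X A \<le> n"
  proof (cases "face_rank X A")
    case (Suc k)
    then have "A \<noteq> {}" by auto
    then have A: "A \<in> C" "cell_dim X A = k"
      using less.prems Suc by (auto simp: faces_def face_rank_nonempty)
    \<comment> \<open>A face exactly one rank lower: the empty face below a vertex, otherwise a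
      facet obtained from invariance of domain.\<close>
    obtain B where B: "B \<in> faces C" "face_le X B A" "face_rank X B = k"
    proof (cases k)
      case 0
      then show ?thesis using that[of "{}"] by (simp add: faces_def face_le_empty)
    next
      case (Suc l)
      then obtain B where "B \<in> C" "cell_dim X A = Suc (cell_dim X B)" "face_le X B A"
        using cell_facet[OF regular A(1)] A(2) by auto
      then show ?thesis
        using that[of B] A(2) cell_nonempty[OF regular, of B]
        by (simp add: faces_def face_rank_nonempty)
    qed
    then have "B \<noteq> A" using Suc by auto
    have "?I B \<subseteq> ?I A" using B face_le_trans by blast
    moreover have "A \<in> ?I A - ?I B"
      using AI B \<open>B \<noteq> A\<close> face_le_antisym less.prems by blast
    ultimately have "card (?I B) < card (?I A)"
      using finite_faces by (intro psubset_card_mono) auto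
    then have "(2::nat) ^ k < 2 ^ n" using IH[of B] B \<open>B \<noteq> A\<close> card by simp
    then show ?thesis using Suc by simp
  qed simp
  ultimately show ?case using card by simp
qed

lemma boolean_poset_faces: "boolean_poset (faces C) (face_le X) {} (face_rank X)"
proof
  show "finite (faces C)" by (rule finite_faces)
  fix A assume A: "A \<in> faces C"
  obtain n g where g: "bij_betw g {B \<in> faces C. face_le X B A} (Pow {..<n::nat})"
    and mono: "\<And>x y. x \<in> {B \<in> faces C. face_le X B A} \<Longrightarrow> y \<in> {B \<in> faces C. face_le X B A} \<Longrightarrow>
      face_le X x y \<longleftrightarrow> g x \<subseteq> g y"
    using face_interval[OF A] by blast
  have "n = face_rank X A"
    using bij_betw_same_card[OF g] card_face_interval[OF A] by (simp add: card_Pow)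
  then show "\<exists>g. bij_betw g {B \<in> faces C. face_le X B A} (Pow {..<face_rank X A}) \<and>
      (\<forall>x\<in>{B \<in> faces C. face_le X B A}. \<forall>y\<in>{B \<in> faces C. face_le X B A}.
        face_le X x y \<longleftrightarrow> g x \<subseteq> g y)"
    using g mono by blast
next
  show "{} \<in> faces C" by (simp add: faces_def)
qed (rule face_le_empty face_le_refl face_le_antisym face_le_trans; assumption)+

end

lemma h_number_eq:
  assumes "complex_dim F dm = int d - 1" "j \<le> d"
  shows "h_number F dm j = coeff (h_poly d (\<lambda>i. int (f_number F dm (int i - 1)))) (d - j)"
  using assms by (simp add: h_number_def h_poly_def Let_def atMost_atLeast0)

theorem theorem2p2:
  fixes X :: "'a topology" and C :: "'a set set" and d j :: nat
  assumes "boolean_cell_complex X C"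
    and "complex_dim (faces C) (face_dim X) = int d - 1"
    and "j \<le> d"
  shows "h_number (sd X C) simplex_dim j =
    (\<Sum>r=0..d. int (eulerian_A (d + 1) (int j) (int r + 1)) * h_number (faces C) (face_dim X) r)"
proof -
  interpret boolean_poset "faces C" "face_le X" "{}" "face_rank X"
    using boolean_poset_faces[OF assms(1)] .
  have sd: "sd X C = Collect chain"
  proof (rule Set.set_eqI)
    fix c show "c \<in> sd X C \<longleftrightarrow> c \<in> Collect chain"
      using chain_finite[of c] by (auto simp: sd_def chain_def)
  qed
  have "Max (face_dim X ` faces C) = int d - 1"
    using assms(2) by (simp add: complex_dim_def)
  moreover have "face_dim X ` faces C \<noteq> {}" using bot(1) by blast
  ultimately have rk_le: "face_rank X A \<le> d" if "A \<in> faces C" for A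
    using Max_ge[of "face_dim X ` faces C" "face_dim X A"] that fin
    by (simp add: face_dim_eq_face_rank)
  have "int d - 1 \<in> face_dim X ` faces C"
    using Max_in[of "face_dim X ` faces C"] \<open>Max (face_dim X ` faces C) = int d - 1\<close>
      \<open>face_dim X ` faces C \<noteq> {}\<close> fin by simp
  then obtain A where A: "A \<in> faces C" "face_rank X A = d"
    by (auto simp: face_dim_eq_face_rank)
  \<comment> \<open>\<open>h_number\<close> reads d off the complex it is given, so both complexes
    must have the same dimension. No chain exceeds d elements, and a face of rank d carries a chain
    with d of them.\<close>
  have dim_sd: "complex_dim (sd X C) simplex_dim = int d - 1"
    unfolding complex_dim_def
  proof (rule Max_eqI)
    have "finite (sd X C)"
      by (rule finite_subset[of _ "Pow (faces C)"]) (use fin in \<open>auto simp: sd_def\<close>)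
    then show "finite (simplex_dim ` sd X C)" by simp
    show "y \<le> int d - 1" if y: "y \<in> simplex_dim ` sd X C" for y
    proof -
      obtain c where "chain c" "y = int (card c) - 1"
        using y by (auto simp: sd simplex_dim_def)
      then show ?thesis using card_chain_le[OF _ rk_le, of c] by simp
    qed
    obtain c where "chain c" "card c = d" using chain_of_card_rk[OF A(1)] A(2) by blast
    then show "int d - 1 \<in> simplex_dim ` sd X C"
      by (auto simp: sd simplex_dim_def intro!: image_eqI[of _ _ c])
  qed
  \<comment> \<open>Both vectors are indexed by rank: the index i stands for dimension i -
    1.\<close>
  define f where "f = (\<lambda>i. int (f_number (faces C) (face_dim X) (int i - 1)))"
  define g where "g = (\<lambda>i. int (f_number (sd X C) simplex_dim (int i - 1)))"
  have f: "f i = int (card {A \<in> faces C. face_rank X A = i})" for i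
    by (simp add: f_def f_number_def face_dim_eq_face_rank)
  have g: "g k = (\<Sum>i\<le>d. f i * int (chain_count i k))" for k
  proof -
    have "g k = int (card {c. chain c \<and> card c = k})"
      by (simp add: g_def f_number_def sd simplex_dim_def)
    also have "\<dots> = int (\<Sum>A\<in>faces C. chain_count (face_rank X A) k)"
      by (simp add: card_chains)
    \<comment> \<open>Faces are grouped by rank, on which alone the number of chains with a given
      top depends.\<close>
    also have "\<dots> = int (\<Sum>i\<le>d. \<Sum>A\<in>{A \<in> faces C. face_rank X A = i}. chain_count (face_rank X A) k)"
      using fin rk_le by (subst sum.group) auto
    also have "\<dots> = (\<Sum>i\<le>d. f i * int (chain_count i k))"
      by (simp add: f)
    finally show ?thesis .
  qed
  have "h_number (sd X C) simplex_dim j = coeff (h_poly d g) (d - j)"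
    unfolding g_def by (rule h_number_eq[OF dim_sd assms(3)])
  also have "\<dots> = (\<Sum>r\<le>d. int (eulerian_A (d + 1) (int j) (int r + 1)) * coeff (h_poly d f) (d - r))"
    using g assms(3) by (rule h_poly_subdivision)
  also have "\<dots> = (\<Sum>r=0..d. int (eulerian_A (d + 1) (int j) (int r + 1)) * h_number (faces C) (face_dim X) r)"
    unfolding f_def atMost_atLeast0 by (rule sum.cong) (auto simp: h_number_eq[OF assms(2)])
  finally show ?thesis .
qed

end
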